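(* Let $A$ be a finite set, $\Omega=A^{\mathbb{N}}$ with the product topology and Borel $\sigma$-algebra $\mathcal{F}$, and let $\mu\in\Delta(\Omega)$ be stationary (invariant under the left shift). Then the ergodic decomposition of $\mu$ is weakly learnable: if $\mu=\int_{\mathcal{E}}\nu\,\lambda(\mathrm{d}\nu)$ is the ergodic decomposition, then for $\lambda$-almost every ergodic $\nu$, the belief $\mu$ weakly merges to $\nu$, i.e. for $\nu$-almost every $\omega=(a_0,a_1,\dots)$, $$\frac{1}{N}\sum_{n=0}^{N-1}\bigl\|\mu(\cdot\mid a_0,\dots,a_{n-1})-\nu(\cdot\mid a_0,\dots,a_{n-1})\bigr\|\xrightarrow[N\to\infty]{}0 .$$
   Context: For $\mu\in\Delta(\Omega)$ and $(a_0,\dots,a_{n-1})\in A^n$ of positive $\mu$-probability, $\mu(\cdot\mid a_0,\dots,a_{n-1})\in\Delta(A)$ denotes the conditional distribution of the $n$-th coordinate $a_n$ given that the first $n$ coordinates are $a_0,\dots,a_{n-1}$. For $p,q\in\Delta(A)$, $\|p-q\|=\max_{a\in A}|p[a]-q[a]|$. A bounded real sequence $(x_n)$ strongly Cesaro converges to $x$ if $\frac1N\sum_{n=0}^{N-1}|x_n-x|\to0$. A belief $\tilde\mu$ weakly merges to $\mu$ if $\|\tilde\mu(\cdot\mid a_0,\dots,a_{n-1})-\mu(\cdot\mid a_0,\dots,a_{n-1})\|$ strongly Cesaro converges to $0$ for $\mu$-a.e. realization. A decomposition of $\mu$ is a standard probability space $(\Theta,\mathcal{B},\lambda)$ with measures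 $\mu_\theta\in\Delta(\Omega)$, $\theta\mapsto\mu_\theta(S)$ measurable, and $\mu(S)=\int\mu_\theta(S)\,\lambda(\mathrm d\theta)$ for all $S\in\mathcal{F}$; it is weakly learnable if $\mu$ weakly merges to $\mu_\theta$ for $\lambda$-a.e. $\theta$. The ergodic beliefs $\mathcal{E}$ are the extreme points of the convex set of stationary measures; every stationary $\mu$ has a unique representation $\mu=\int\nu\,\lambda(\mathrm d\nu)$ with $\lambda\in\Delta(\mathcal{E})$, called the ergodic decomposition. *)

theory Defs
  imports "HOL-Probability.Probability"
begin

text \<open>The sequence space Omega = A^nat with the product (= Borel of the product topology,
  A finite discrete) sigma-algebra.\<close>
definition Omega :: "(nat \<Rightarrow> 'a) measure" where
  "Omega = PiM UNIV (\<lambda>_. count_space UNIV)"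

definition shift :: "(nat \<Rightarrow> 'a) \<Rightarrow> nat \<Rightarrow> 'a" where
  "shift \<omega> = (\<lambda>n. \<omega> (Suc n))"

definition stationary :: "(nat \<Rightarrow> 'a) measure \<Rightarrow> bool" where
  "stationary \<mu> \<longleftrightarrow> \<mu> \<in> space (prob_algebra Omega) \<and> distr \<mu> Omega shift = \<mu>"

definition ergodic :: "(nat \<Rightarrow> 'a) measure \<Rightarrow> bool" where
  "ergodic \<nu> \<longleftrightarrow> stationary \<nu> \<and>
     \<not> (\<exists>\<nu>1 \<nu>2 t. stationary \<nu>1 \<and> stationary \<nu>2 \<and> \<nu>1 \<noteq> \<nu>2 \<and> 0 < t \<and> t < (1::real) \<and>
          (\<forall>S\<in>sets Omega. measure \<nu> S = t * measure \<nu>1 S + (1 - t) * measure \<nu>2 S))"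

definition cyl :: "'a list \<Rightarrow> (nat \<Rightarrow> 'a) set" where
  "cyl xs = {\<omega>. \<forall>i<length xs. \<omega> i = xs ! i}"

text \<open>Conditional probability mu(a | xs) that the next coordinate is a given the prefix xs
  (Isabelle's convention x/0 = 0 applies on prefixes of probability zero).\<close>
definition cond :: "(nat \<Rightarrow> 'a) measure \<Rightarrow> 'a list \<Rightarrow> 'a \<Rightarrow> real" where
  "cond \<mu> xs a = measure \<mu> (cyl (xs @ [a])) / measure \<mu> (cyl xs)"

definition prefix_of :: "(nat \<Rightarrow> 'a) \<Rightarrow> nat \<Rightarrow> 'a list" where
  "prefix_of \<omega> n = map \<omega> [0..<n]"

definition cond_dist :: "(nat \<Rightarrow> 'a::finite) measure \<Rightarrow> (nat \<Rightarrow> 'a) measure \<Rightarrow> 'a list \<Rightarrow> real" where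
  "cond_dist \<mu> \<nu> xs = Max (range (\<lambda>a. \<bar>cond \<mu> xs a - cond \<nu> xs a\<bar>))"

definition strong_cesaro :: "(nat \<Rightarrow> real) \<Rightarrow> real \<Rightarrow> bool" where
  "strong_cesaro x L \<longleftrightarrow> (\<lambda>N. (\<Sum>n<N. \<bar>x n - L\<bar>) / real N) \<longlonglongrightarrow> 0"

definition weakly_merges :: "(nat \<Rightarrow> 'a::finite) measure \<Rightarrow> (nat \<Rightarrow> 'a) measure \<Rightarrow> bool" where
  "weakly_merges \<mu>t \<mu> \<longleftrightarrow>
     (AE \<omega> in \<mu>. strong_cesaro (\<lambda>n. cond_dist \<mu>t \<mu> (prefix_of \<omega> n)) 0)"

end

theory Submission
  imports Defs
begin

text \<open>Fix a letter \<open>a\<close> and write \<open>M\<close> and \<open>F\<close> for its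
  conditional probabilities under \<open>mu\<close> and under a component \<open>\<nu>\<close>. Reading words backwards in time,
  both are martingales under the respective stationary measure, so Kolmogorov's inequality shows that,
  for \<open>k\<close> large, they stay close to their values at window length \<open>k\<close> for all longer windows at once,
  outside a small event; for \<open>M\<close> this passes from \<open>mu\<close> to the components by averaging.

  The mean square difference of \<open>F\<close> and \<open>M\<close> at window length \<open>n\<close> vanishes as \<open>n\<close> grows. For a weight
  \<open>f\<close> on the components, \<open>E[f | a\<^sub>0, \<dots>, a\<^sub>n\<^sub>-\<^sub>1]\<close> is a bounded martingale, whose square-summable
  increments force \<open>E |E[f (F - M) | a\<^sub>0, \<dots>, a\<^sub>n\<^sub>-\<^sub>1]|\<close> to \<open>0\<close>. This is applied with \<open>f\<close> the value of
  \<open>F\<close> on the last \<open>k\<close> letters, which is close to \<open>F\<close> itself in mean square.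

  The maximal ergodic inequality, applied to an upper bound of \<open>|F - M|\<close> over all windows longer than
  \<open>k\<close> (Maker's argument), then controls all Cesaro averages simultaneously.\<close>

section \<open>Words and stationary weights\<close>

definition words :: "nat \<Rightarrow> 'a list set" where
  "words n = {xs. length xs = n}"

lemma finite_words [simp]: "finite (words n :: 'a::finite list set)"
  using finite_lists_length_eq[of "UNIV :: 'a set" n] by (simp add: words_def)

lemma words_0 [simp]: "words 0 = {[]}"
  by (auto simp: words_def)

lemma sum_words_append:
  fixes f :: "'a::finite list \<Rightarrow> real"
  shows "sum f (words (m + n)) = (\<Sum>xs\<in>words n. \<Sum>ys\<in>words m. f (ys @ xs))"
proof -
  have "sum f (words (m + n)) = (\<Sum>(xs, ys)\<in>words n \<times> words m. f (ys @ xs))"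
    by (rule sum.reindex_bij_witness[where i = "\<lambda>(xs, ys). ys @ xs"
          and j = "\<lambda>zs. (drop m zs, take m zs)"])
      (auto simp: words_def)
  then show ?thesis by (simp add: sum.cartesian_product)
qed

lemma sum_words_1:
  fixes f :: "'a::finite list \<Rightarrow> real"
  shows "sum f (words (Suc 0)) = (\<Sum>a\<in>UNIV. f [a])"
  by (rule sum.reindex_bij_witness[where i = "\<lambda>a. [a]" and j = hd])
    (auto simp: words_def length_Suc_conv)

lemma sum_words_snoc:
  fixes f :: "'a::finite list \<Rightarrow> real"
  shows "sum f (words (Suc n)) = (\<Sum>xs\<in>words n. \<Sum>a\<in>UNIV. f (xs @ [a]))"
  using sum_words_append[of f n 1] by (simp add: sum_words_1 sum.swap[of _ UNIV])

text \<open>Cylinder probabilities of a stationary process: additivity on the right is consistency,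
  additivity on the left is shift invariance.\<close>

locale stationary_weight =
  fixes w :: "'a::finite list \<Rightarrow> real"
  assumes w_nonneg: "0 \<le> w xs"
    and w_Nil: "w [] = 1"
    and w_snoc: "(\<Sum>a\<in>UNIV. w (xs @ [a])) = w xs"
    and w_Cons: "(\<Sum>a\<in>UNIV. w (a # xs)) = w xs"
begin

definition cp :: "'a \<Rightarrow> 'a list \<Rightarrow> real" where
  "cp a xs = w (xs @ [a]) / w xs"

definition second_moment :: "'a \<Rightarrow> nat \<Rightarrow> real" where
  "second_moment a n = (\<Sum>xs\<in>words n. w xs * (cp a xs)\<^sup>2)"

lemma w_snoc_le: "w (xs @ [a]) \<le> w xs"
  unfolding w_snoc[of xs, symmetric] by (rule member_le_sum) (auto simp: w_nonneg)

text \<open>The convention \<open>x / 0 = 0\<close> does no harm: where \<open>w xs\<close>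
  vanishes, so does the numerator of \<open>cp\<close>.\<close>

lemma w_mult_cp: "w xs * cp a xs = w (xs @ [a])"
  using w_snoc_le[of xs a] w_nonneg[of "xs @ [a]"] by (auto simp: cp_def)

lemma cp_nonneg: "0 \<le> cp a xs"
  by (simp add: cp_def w_nonneg)

lemma cp_le_1: "cp a xs \<le> 1"
  using w_snoc_le[of xs a] w_nonneg[of xs] by (auto simp: cp_def divide_le_eq)

lemma sum_words_left: "(\<Sum>ys\<in>words h. w (ys @ xs)) = w xs"
proof (induction h)
  case (Suc h)
  have "(\<Sum>ys\<in>words (Suc h). w (ys @ xs)) = (\<Sum>ys\<in>words h. \<Sum>a\<in>UNIV. w (a # ys @ xs))"
    using sum_words_append[of "\<lambda>ys. w (ys @ xs)" "Suc 0" h] by (simp add: sum_words_1)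
  then show ?case using Suc by (simp add: w_Cons)
qed auto

lemma sum_words_w: "(\<Sum>xs\<in>words n. w xs) = 1"
  using sum_words_left[of "[]" n] by (simp add: w_Nil)

text \<open>The martingale property towards the past: multiplied by the weight, \<open>cp\<close>
  becomes the weight of the word with \<open>a\<close> appended, to which left additivity of
  \<open>w\<close> applies.\<close>

lemma sum_words_left_cp: "(\<Sum>ys\<in>words h. w (ys @ xs) * cp a (ys @ xs)) = w xs * cp a xs"
  using sum_words_left[of "xs @ [a]" h] by (simp add: w_mult_cp)

text \<open>The linear term collapses by the martingale property. The centre \<open>m\<close> is
  left free because Kolmogorov's induction keeps it fixed while the window \<open>xs\<close>
  grows.\<close>

lemma sum_square_deviation:
  "(\<Sum>ys\<in>words h. w (ys @ xs) * (cp a (ys @ xs) - m)\<^sup>2) =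
   (\<Sum>ys\<in>words h. w (ys @ xs) * (cp a (ys @ xs))\<^sup>2) - 2 * m * (w xs * cp a xs) + m\<^sup>2 * w xs"
proof -
  have "(\<Sum>ys\<in>words h. w (ys @ xs) * (cp a (ys @ xs) - m)\<^sup>2) =
    (\<Sum>ys\<in>words h. w (ys @ xs) * (cp a (ys @ xs))\<^sup>2 - 2 * m * (w (ys @ xs) * cp a (ys @ xs))
      + m\<^sup>2 * w (ys @ xs))"
    by (rule sum.cong) (auto simp: power2_eq_square algebra_simps)
  then show ?thesis
    by (simp add: sum.distrib sum_subtractf sum_words_left sum_words_left_cp
        flip: sum_distrib_left)
qed

text \<open>Conditional Jensen: the two sides differ by the weighted squares around
  \<open>cp a xs\<close>, an unnormalised conditional variance.\<close>

lemma square_deviation_le: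
  "w xs * (cp a xs - m)\<^sup>2 \<le> (\<Sum>ys\<in>words h. w (ys @ xs) * (cp a (ys @ xs) - m)\<^sup>2)"
proof -
  have "0 \<le> (\<Sum>ys\<in>words h. w (ys @ xs) * (cp a (ys @ xs) - cp a xs)\<^sup>2)"
    by (intro sum_nonneg) (simp add: w_nonneg)
  then show ?thesis
    unfolding sum_square_deviation by (simp add: power2_eq_square algebra_simps)
qed

text \<open>Orthogonality of martingale increments: at \<open>m = cp a xs\<close> the cross term and
  the square of the centre combine to minus the second moment at length \<open>k\<close>.\<close>

lemma sum_increment_squares:
  "(\<Sum>xs\<in>words k. \<Sum>ys\<in>words h. w (ys @ xs) * (cp a (ys @ xs) - cp a xs)\<^sup>2) =
   second_moment a (h + k) - second_moment a k"
  unfolding sum_square_deviation second_moment_def sum_words_append[of _ h k]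
  by (simp add: power2_eq_square sum.distrib sum_subtractf algebra_simps)

lemma second_moment_mono: "k \<le> n \<Longrightarrow> second_moment a k \<le> second_moment a n"
proof -
  assume "k \<le> n"
  then obtain h where "n = h + k" by (metis le_add_diff_inverse2)
  moreover have "0 \<le> (\<Sum>xs\<in>words k. \<Sum>ys\<in>words h. w (ys @ xs) * (cp a (ys @ xs) - cp a xs)\<^sup>2)"
    by (intro sum_nonneg) (simp add: w_nonneg)
  ultimately show ?thesis by (simp add: sum_increment_squares)
qed

lemma second_moment_le_1: "second_moment a n \<le> 1"
proof -
  have "second_moment a n \<le> (\<Sum>xs\<in>words n. w xs)"
    unfolding second_moment_def
    by (intro sum_mono mult_left_le) (auto simp: w_nonneg cp_nonneg cp_le_1 power_le_one)
  then show ?thesis by (simp add: sum_words_w)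
qed

end

section \<open>Kolmogorov's maximal inequality for windows growing into the past\<close>

definition deviates :: "('a list \<Rightarrow> real) \<Rightarrow> real \<Rightarrow> real \<Rightarrow> 'a list \<Rightarrow> 'a list \<Rightarrow> bool" where
  "deviates M m e ys xs \<longleftrightarrow> (\<exists>i\<le>length ys. e < \<bar>M (drop i ys @ xs) - m\<bar>)"

text \<open>Moving the letter next to \<open>xs\<close> from the extension into the window sets up
  Kolmogorov's induction. The extra disjunct is the window \<open>xs\<close> itself, reached when
  the whole extension is dropped.\<close>

lemma deviates_snoc:
  "deviates M m e (ys @ [a]) xs \<longleftrightarrow> deviates M m e ys (a # xs) \<or> e < \<bar>M xs - m\<bar>"
proof -
  have *: "(\<exists>i\<le>Suc n. P i) \<longleftrightarrow> (\<exists>i\<le>n. P i) \<or> P (Suc n)" for P n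
    by (auto simp: le_Suc_eq)
  show ?thesis
    unfolding deviates_def length_append_singleton * by (auto 4 3)
qed

context stationary_weight
begin

text \<open>Windows are examined from the shortest on, stopping at the first that deviates from
  \<open>m\<close>. There \<open>square_deviation_le\<close> pays for all extensions at once; before
  that, the induction splits over the letter \<open>b\<close> preceding the window.\<close>

lemma kolmogorov_words:
  assumes e: "0 < e"
  shows "e\<^sup>2 * (\<Sum>ys\<in>words h. w (ys @ xs) * of_bool (deviates (cp a) m e ys xs))
    \<le> (\<Sum>ys\<in>words h. w (ys @ xs) * (cp a (ys @ xs) - m)\<^sup>2)"
proof (induction h arbitrary: xs)
  case 0
  have "e\<^sup>2 \<le> (cp a xs - m)\<^sup>2" if "e < \<bar>cp a xs - m\<bar>"
    using that e by (metis abs_le_square_iff abs_of_pos less_imp_le)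
  then show ?case
    by (auto simp: deviates_def w_nonneg mult.commute intro!: mult_left_mono)
next
  case (Suc h)
  show ?case
  proof (cases "e < \<bar>cp a xs - m\<bar>")
    case True
    then have le: "e\<^sup>2 \<le> (cp a xs - m)\<^sup>2"
      using e by (metis abs_le_square_iff abs_of_pos less_imp_le)
    have "(\<Sum>ys\<in>words (Suc h). w (ys @ xs) * of_bool (deviates (cp a) m e ys xs))
      \<le> (\<Sum>ys\<in>words (Suc h). w (ys @ xs))"
      by (intro sum_mono) (auto simp: w_nonneg)
    then have "e\<^sup>2 * (\<Sum>ys\<in>words (Suc h). w (ys @ xs) * of_bool (deviates (cp a) m e ys xs))
      \<le> (cp a xs - m)\<^sup>2 * w xs"
      using le by (intro mult_mono) (auto simp: sum_words_left w_nonneg intro!: sum_nonneg)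
    then show ?thesis
      using square_deviation_le[of xs a m "Suc h"] by (simp add: mult.commute)
  next
    case False
    have "e\<^sup>2 * (\<Sum>ys\<in>words (Suc h). w (ys @ xs) * of_bool (deviates (cp a) m e ys xs))
      = (\<Sum>b\<in>UNIV. e\<^sup>2 * (\<Sum>ys\<in>words h. w (ys @ b # xs) * of_bool (deviates (cp a) m e ys (b # xs))))"
      unfolding sum_words_snoc using False
      by (subst sum.swap) (simp add: deviates_snoc sum_distrib_left del: sum_mult_of_bool_eq)
    also have "\<dots> \<le> (\<Sum>b\<in>UNIV. \<Sum>ys\<in>words h. w (ys @ b # xs) * (cp a (ys @ b # xs) - m)\<^sup>2)"
      by (intro sum_mono Suc)
    also have "\<dots> = (\<Sum>ys\<in>words (Suc h). w (ys @ xs) * (cp a (ys @ xs) - m)\<^sup>2)"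
      by (simp add: sum_words_snoc sum.swap[of _ UNIV])
    finally show ?thesis .
  qed
qed

text \<open>Kolmogorov's inequality centred at the value on the short window. Second moments
  increase and are at most one, so for large \<open>k\<close> the bound is small uniformly in
  \<open>h\<close>.\<close>

lemma prob_deviates_le:
  assumes e: "0 < e"
  shows "(\<Sum>xs\<in>words k. \<Sum>ys\<in>words h. w (ys @ xs) * of_bool (deviates (cp a) (cp a xs) e ys xs))
    \<le> (second_moment a (h + k) - second_moment a k) / e\<^sup>2"
proof -
  have "e\<^sup>2 * (\<Sum>xs\<in>words k. \<Sum>ys\<in>words h. w (ys @ xs) * of_bool (deviates (cp a) (cp a xs) e ys xs))
    \<le> (\<Sum>xs\<in>words k. \<Sum>ys\<in>words h. w (ys @ xs) * (cp a (ys @ xs) - cp a xs)\<^sup>2)"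
    by (subst sum_distrib_left) (intro sum_mono kolmogorov_words e)
  then show ?thesis
    unfolding sum_increment_squares using e by (simp add: field_simps)
qed

end

section \<open>Stationary measures on sequence space\<close>

lemma space_Omega [simp]: "space Omega = UNIV"
  by (simp add: Omega_def space_PiM)

lemma measurable_coord [measurable]: "(\<lambda>\<omega>. \<omega> i) \<in> Omega \<rightarrow>\<^sub>M count_space UNIV"
  unfolding Omega_def by measurable

lemma measurable_shift [measurable]: "shift \<in> Omega \<rightarrow>\<^sub>M Omega"
proof -
  have "shift \<in> Omega \<rightarrow>\<^sub>M PiM UNIV (\<lambda>_. count_space UNIV)"
    unfolding shift_def by (rule measurable_PiM_single') auto
  then show ?thesis by (simp add: Omega_def)
qed

lemma length_prefix_of [simp]: "length (prefix_of \<omega> n) = n"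
  by (simp add: prefix_of_def)

lemma prefix_of_in_words: "prefix_of \<omega> n \<in> words n"
  by (simp add: words_def)

lemma mem_cyl_iff: "\<omega> \<in> cyl xs \<longleftrightarrow> prefix_of \<omega> (length xs) = xs"
  unfolding cyl_def prefix_of_def list_eq_iff_nth_eq by simp

lemma sets_cyl [measurable]: "cyl xs \<in> sets Omega"
proof -
  have "{\<omega>\<in>space Omega. \<forall>i<length xs. \<omega> i = xs ! i} \<in> sets Omega"
    by measurable
  then show ?thesis by (simp add: cyl_def)
qed

lemma cyl_snoc: "cyl (xs @ [a]) = {\<omega> \<in> cyl xs. \<omega> (length xs) = a}"
  by (auto simp: cyl_def All_less_Suc nth_append)

lemma cyl_Cons: "cyl (a # xs) = {\<omega>. \<omega> 0 = a \<and> shift \<omega> \<in> cyl xs}"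
  unfolding cyl_def shift_def by (simp add: All_less_Suc2)

lemma cyl_snoc_subset: "cyl (xs @ [a]) \<subseteq> cyl xs"
  unfolding cyl_snoc by blast

lemma measurable_prefix_of [measurable]:
  "(\<lambda>\<omega>. prefix_of \<omega> n) \<in> Omega \<rightarrow>\<^sub>M count_space (UNIV :: 'a::finite list set)"
proof (subst measurable_count_space_eq2_countable, safe)
  fix xs :: "'a list"
  have "(\<lambda>\<omega>. prefix_of \<omega> n) -` {xs} \<inter> space Omega = (if length xs = n then cyl xs else {})"
    by (auto simp: mem_cyl_iff)
  then show "(\<lambda>\<omega>. prefix_of \<omega> n) -` {xs} \<inter> space Omega \<in> sets Omega"
    by auto
qed auto

lemma stationaryD:
  assumes "stationary \<rho>"
  shows "prob_space \<rho>" "sets \<rho> = sets Omega" "distr \<rho> Omega shift = \<rho>"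
  using assms by (auto simp: stationary_def space_prob_algebra)

context
  fixes \<rho> :: "(nat \<Rightarrow> 'a::finite) measure"
  assumes prob: "prob_space \<rho>" and sets_eq: "sets \<rho> = sets Omega"
begin

interpretation prob_space \<rho> by (fact prob)

lemma integral_prefix_of:
  fixes f :: "'a list \<Rightarrow> real"
  shows "(\<integral>\<omega>. f (prefix_of \<omega> n) \<partial>\<rho>) = (\<Sum>xs\<in>words n. measure \<rho> (cyl xs) * f xs)"
proof -
  have "f (prefix_of \<omega> n) = (\<Sum>xs\<in>words n. f xs * indicator (cyl xs) \<omega>)" for \<omega>
  proof -
    have "(\<Sum>xs\<in>words n. f xs * indicator (cyl xs) \<omega>) = (\<Sum>xs\<in>words n. if xs = prefix_of \<omega> n then f xs else 0)"
      by (rule sum.cong) (auto simp: mem_cyl_iff words_def indicator_def)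
    then show ?thesis by (simp add: prefix_of_in_words)
  qed
  then have "(\<integral>\<omega>. f (prefix_of \<omega> n) \<partial>\<rho>) = (\<integral>\<omega>. (\<Sum>xs\<in>words n. f xs * indicator (cyl xs) \<omega>) \<partial>\<rho>)"
    by simp
  also have "\<dots> = (\<Sum>xs\<in>words n. \<integral>\<omega>. f xs * indicator (cyl xs) \<omega> \<partial>\<rho>)"
    by (rule Bochner_Integration.integral_sum) (auto simp: sets_eq emeasure_eq_measure)
  also have "\<dots> = (\<Sum>xs\<in>words n. measure \<rho> (cyl xs) * f xs)"
    by (intro sum.cong) (auto simp: sets_eq)
  finally show ?thesis .
qed

lemma measure_prefix_of:
  "measure \<rho> {\<omega>. P (prefix_of \<omega> n)} = (\<Sum>xs\<in>words n. measure \<rho> (cyl xs) * of_bool (P xs))"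
proof -
  have "{\<omega>. P (prefix_of \<omega> n)} \<in> sets \<rho>"
  proof -
    have "{\<omega>\<in>space Omega. P (prefix_of \<omega> n)} \<in> sets Omega" by measurable
    then show ?thesis by (simp add: sets_eq)
  qed
  then have "measure \<rho> {\<omega>. P (prefix_of \<omega> n)} = (\<integral>\<omega>. indicator {\<omega>. P (prefix_of \<omega> n)} \<omega> \<partial>\<rho>)"
    by simp
  also have "\<dots> = (\<integral>\<omega>. of_bool (P (prefix_of \<omega> n)) \<partial>\<rho>)"
    by (intro Bochner_Integration.integral_cong) (auto simp: indicator_def)
  also have "\<dots> = (\<Sum>xs\<in>words n. measure \<rho> (cyl xs) * of_bool (P xs))"
    by (rule integral_prefix_of)
  finally show ?thesis .
qed

lemma measure_cyl_Nil: "measure \<rho> (cyl []) = 1"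
  using prob_space sets_eq_imp_space_eq[OF sets_eq] by (simp add: cyl_def)

lemma measure_cyl_snoc: "(\<Sum>a\<in>UNIV. measure \<rho> (cyl (xs @ [a]))) = measure \<rho> (cyl xs)"
proof -
  have "disjoint_family (\<lambda>a. cyl (xs @ [a]))"
    unfolding disjoint_family_on_def cyl_snoc by blast
  then have "(\<Sum>a\<in>UNIV. measure \<rho> (cyl (xs @ [a]))) = measure \<rho> (\<Union>a\<in>UNIV. cyl (xs @ [a]))"
    by (intro finite_measure_finite_Union[symmetric]) (auto simp: sets_eq)
  also have "(\<Union>a\<in>UNIV. cyl (xs @ [a])) = cyl xs"
    unfolding cyl_snoc by blast
  finally show ?thesis .
qed

end

text \<open>Additivity on the left is invariance: the preimage of a cylinder under the shift is a
  disjoint union over the new first letter.\<close>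

lemma stationary_weight_measure:
  fixes \<rho> :: "(nat \<Rightarrow> 'a::finite) measure"
  assumes "stationary \<rho>"
  shows "stationary_weight (\<lambda>xs. measure \<rho> (cyl xs))"
proof -
  note \<rho> = stationaryD[OF assms]
  interpret prob_space \<rho> by (rule \<rho>)
  have Cons: "(\<Sum>a\<in>UNIV. measure \<rho> (cyl (a # xs))) = measure \<rho> (cyl xs)" for xs
  proof -
    have eq: "shift -` cyl xs = (\<Union>a\<in>UNIV. cyl (a # xs))"
      by (auto simp: cyl_Cons)
    have "measure \<rho> (cyl xs) = measure (distr \<rho> Omega shift) (cyl xs)"
      by (simp add: \<rho>)
    also have "\<dots> = measure \<rho> (shift -` cyl xs)"
      using sets_eq_imp_space_eq[OF \<rho>(2)]
      by (subst measure_distr) (auto simp: measurable_cong_sets[OF \<rho>(2) refl])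
    also have "\<dots> = (\<Sum>a\<in>UNIV. measure \<rho> (cyl (a # xs)))"
    proof -
      have "disjoint_family (\<lambda>a. cyl (a # xs))"
        by (auto simp: disjoint_family_on_def cyl_Cons)
      then show ?thesis
        unfolding eq by (intro finite_measure_finite_Union) (auto simp: \<rho>)
    qed
    finally show ?thesis by simp
  qed
  show ?thesis
    by standard (auto simp: measure_cyl_Nil measure_cyl_snoc \<rho> Cons)
qed

lemma cond_nonneg: "0 \<le> cond \<rho> xs a"
  by (simp add: cond_def)

lemma cond_le_1:
  assumes "prob_space \<rho>" "sets \<rho> = sets Omega"
  shows "cond \<rho> xs a \<le> 1"
proof -
  interpret prob_space \<rho> by fact
  have "measure \<rho> (cyl (xs @ [a])) \<le> measure \<rho> (cyl xs)"
    by (rule finite_measure_mono) (simp_all add: cyl_snoc_subset assms)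
  then show ?thesis
    using measure_nonneg[of \<rho> "cyl xs"] by (auto simp: cond_def divide_le_eq)
qed

lemma measure_cyl_mult_cond:
  assumes "prob_space \<rho>" "sets \<rho> = sets Omega"
  shows "measure \<rho> (cyl xs) * cond \<rho> xs a = measure \<rho> (cyl (xs @ [a]))"
proof -
  interpret prob_space \<rho> by fact
  have "measure \<rho> (cyl (xs @ [a])) \<le> measure \<rho> (cyl xs)"
    by (rule finite_measure_mono) (simp_all add: cyl_snoc_subset assms)
  then show ?thesis
    by (auto simp: cond_def measure_le_0_iff)
qed

section \<open>The maximal ergodic inequality\<close>

text \<open>The positive part of the largest of the first \<open>n\<close> ergodic sums.\<close>

fun max_ergodic_sum :: "((nat \<Rightarrow> 'a) \<Rightarrow> real) \<Rightarrow> nat \<Rightarrow> (nat \<Rightarrow> 'a) \<Rightarrow> real" where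
  "max_ergodic_sum f 0 \<omega> = 0"
| "max_ergodic_sum f (Suc n) \<omega> = max 0 (f \<omega> + max_ergodic_sum f n (shift \<omega>))"

lemma max_ergodic_sum_nonneg: "0 \<le> max_ergodic_sum f n \<omega>"
  by (cases n) auto

lemma max_ergodic_sum_mono: "max_ergodic_sum f n \<omega> \<le> max_ergodic_sum f (Suc n) \<omega>"
proof (induction n arbitrary: \<omega>)
  case (Suc n)
  have "max 0 (f \<omega> + max_ergodic_sum f n (shift \<omega>))
    \<le> max 0 (f \<omega> + max_ergodic_sum f (Suc n) (shift \<omega>))"
    by (intro max.mono add_left_mono Suc order_refl)
  then show ?case by simp
qed auto

lemma ergodic_sum_le_max:
  "N \<le> K \<Longrightarrow> (\<Sum>n<N. f ((shift ^^ n) \<omega>)) \<le> max_ergodic_sum f K \<omega>"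
proof (induction K arbitrary: N \<omega>)
  case (Suc K)
  show ?case
  proof (cases N)
    case (Suc N')
    then have "(\<Sum>n<N. f ((shift ^^ n) \<omega>)) = f \<omega> + (\<Sum>n<N'. f ((shift ^^ n) (shift \<omega>)))"
      by (simp add: sum.lessThan_Suc_shift funpow_swap1 del: sum.lessThan_Suc)
    also have "\<dots> \<le> f \<omega> + max_ergodic_sum f K (shift \<omega>)"
      using Suc.IH[of N' "shift \<omega>"] Suc.prems Suc by simp
    finally show ?thesis by simp
  qed auto
qed auto

lemma measurable_max_ergodic_sum [measurable]:
  "f \<in> borel_measurable Omega \<Longrightarrow> max_ergodic_sum f n \<in> borel_measurable Omega"
proof (induction n)
  case 0
  have "max_ergodic_sum f 0 = (\<lambda>_. 0)" by auto
  then show ?case by simp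
next
  case (Suc n)
  note [measurable] = Suc.prems Suc.IH[OF Suc.prems]
  have "max_ergodic_sum f (Suc n) = (\<lambda>\<omega>. max 0 (f \<omega> + max_ergodic_sum f n (shift \<omega>)))"
    by auto
  then show ?case by simp
qed

lemma abs_max_ergodic_sum_le:
  "(\<And>\<omega>. \<bar>f \<omega>\<bar> \<le> B) \<Longrightarrow> \<bar>max_ergodic_sum f n \<omega>\<bar> \<le> real n * B"
proof (induction n arbitrary: \<omega>)
  case (Suc n)
  then have "\<bar>f \<omega>\<bar> \<le> B" "\<bar>max_ergodic_sum f n (shift \<omega>)\<bar> \<le> real n * B" by auto
  then show ?case by (auto simp: algebra_simps)
qed auto

text \<open>Garsia's argument, with \<open>n = Suc m\<close>. Where the maximal sum of
  \<open>n\<close> steps is positive, it is \<open>f\<close> plus the maximal sum of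
  \<open>m\<close> steps at the shifted point; elsewhere it exceeds the latter by at most zero.
  After integration, invariance removes the shift and monotonicity in the number of steps gives the
  sign.\<close>

lemma maximal_ergodic:
  assumes st: "stationary \<rho>"
    and f [measurable]: "f \<in> borel_measurable Omega" and B: "\<And>\<omega>. \<bar>f \<omega>\<bar> \<le> B"
  shows "0 \<le> (\<integral>\<omega>. indicator {\<omega>. 0 < max_ergodic_sum f n \<omega>} \<omega> * f \<omega> \<partial>\<rho>)"
proof (cases n)
  case (Suc m)
  note \<rho> = stationaryD[OF st]
  interpret prob_space \<rho> by (rule \<rho>)
  note meas = measurable_cong_sets[OF \<rho>(2) refl]
  have B0: "0 \<le> B" using B[of undefined] by linarith
  let ?M = "max_ergodic_sum f"
  have int: "integrable \<rho> (?M k)" for k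
    by (rule integrable_const_bound[of _ "real k * B"])
      (auto simp: meas abs_max_ergodic_sum_le B)
  have ints: "integrable \<rho> (\<lambda>\<omega>. ?M k (shift \<omega>))" for k
    by (rule integrable_const_bound[of _ "real k * B"])
      (auto simp: meas abs_max_ergodic_sum_le B)
  have set [measurable]: "{\<omega>. 0 < ?M n \<omega>} \<in> sets Omega"
  proof -
    have "{\<omega>\<in>space Omega. 0 < ?M n \<omega>} \<in> sets Omega" by measurable
    then show ?thesis by simp
  qed
  have inti: "integrable \<rho> (\<lambda>\<omega>. indicator {\<omega>. 0 < ?M n \<omega>} \<omega> * f \<omega>)"
    by (rule integrable_const_bound[of _ B])
      (auto simp: meas B indicator_def B0)
  have "(\<integral>\<omega>. ?M m (shift \<omega>) \<partial>\<rho>) = (\<integral>\<omega>. ?M m \<omega> \<partial>distr \<rho> Omega shift)"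
    by (rule integral_distr[symmetric]) (auto simp: meas)
  also have "\<dots> = (\<integral>\<omega>. ?M m \<omega> \<partial>\<rho>)" by (simp add: \<rho>)
  also have "\<dots> \<le> (\<integral>\<omega>. ?M n \<omega> \<partial>\<rho>)"
    unfolding Suc by (intro integral_mono int max_ergodic_sum_mono)
  finally have "0 \<le> (\<integral>\<omega>. ?M n \<omega> - ?M m (shift \<omega>) \<partial>\<rho>)"
    using int ints by simp
  also have "\<dots> \<le> (\<integral>\<omega>. indicator {\<omega>. 0 < ?M n \<omega>} \<omega> * f \<omega> \<partial>\<rho>)"
  proof (intro integral_mono inti Bochner_Integration.integrable_diff int ints)
    fix \<omega>
    show "?M n \<omega> - ?M m (shift \<omega>) \<le> indicator {\<omega>. 0 < ?M n \<omega>} \<omega> * f \<omega>"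
      using max_ergodic_sum_nonneg[of f m "shift \<omega>"] by (auto simp: Suc indicator_def)
  qed
  finally show ?thesis .
qed auto

section \<open>Prefixes as tails of shifted windows\<close>

lemma funpow_shift: "(shift ^^ n) \<omega> i = \<omega> (n + i)"
  by (induction n arbitrary: \<omega> i) (auto simp: funpow_swap1 shift_def)

lemma take_prefix_of: "n \<le> K \<Longrightarrow> take n (prefix_of \<omega> K) = prefix_of \<omega> n"
  by (simp add: prefix_of_def take_map)

text \<open>Both windows end just before time \<open>n + K\<close>, and the shorter one begins at
  time \<open>K\<close>.\<close>

lemma prefix_of_funpow_shift:
  assumes "n \<le> K"
  shows "prefix_of ((shift ^^ K) \<omega>) n = drop (K - n) (prefix_of ((shift ^^ n) \<omega>) K)"
  using assms by (auto simp: list_eq_iff_nth_eq prefix_of_def funpow_shift)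

lemma measure_vimage_funpow_shift:
  assumes "stationary \<rho>" and S: "S \<in> sets Omega"
  shows "measure \<rho> ((shift ^^ n) -` S) = measure \<rho> S"
proof (induction n)
  case (Suc n)
  note \<rho> = stationaryD[OF assms(1)]
  have meas: "(shift ^^ n) \<in> Omega \<rightarrow>\<^sub>M Omega" for n
    by (induction n) (auto intro: measurable_comp[OF _ measurable_shift])
  have "(shift ^^ n) -` S \<inter> space Omega \<in> sets Omega"
    by (rule measurable_sets[OF meas S])
  then have "(shift ^^ n) -` S \<in> sets Omega" by simp
  then have "measure (distr \<rho> Omega shift) ((shift ^^ n) -` S) = measure \<rho> (shift -` (shift ^^ n) -` S)"
    using sets_eq_imp_space_eq[OF \<rho>(2)]
    by (subst measure_distr) (auto simp: measurable_cong_sets[OF \<rho>(2) refl])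
  moreover have "shift -` (shift ^^ n) -` S = (shift ^^ Suc n) -` S"
    by (simp add: funpow_Suc_right vimage_comp del: funpow.simps)
  ultimately show ?case using Suc by (simp add: \<rho> del: funpow.simps)
qed auto

text \<open>After shifting the event by \<open>K\<close> steps, every prefix of length \<open>n \<le> K\<close> becomes a suffix of
  the window of length \<open>K\<close> starting at time \<open>n\<close>; this is what allows the maximal inequality to be
  applied without passing to two-sided sequences.\<close>

lemma maximal_prefix_average:
  fixes \<rho> :: "(nat \<Rightarrow> 'a::finite) measure" and g H :: "'a list \<Rightarrow> real"
  assumes st: "stationary \<rho>" and eps: "0 < \<epsilon>"
    and g: "\<And>zs j. length zs = K \<Longrightarrow> k \<le> j \<Longrightarrow> j \<le> K \<Longrightarrow> g (drop (K - j) zs) \<le> H zs"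
    and H: "\<And>zs. 0 \<le> H zs"
  shows "\<epsilon> * measure \<rho> {\<omega>. \<exists>N\<le>K. \<epsilon> * real N < (\<Sum>n\<in>{k..<N}. g (prefix_of \<omega> n))}
    \<le> (\<Sum>zs\<in>words K. measure \<rho> (cyl zs) * H zs)"
proof -
  note \<rho> = stationaryD[OF st]
  interpret prob_space \<rho> by (rule \<rho>)
  note meas = measurable_cong_sets[OF \<rho>(2) refl]
  define f where "f \<omega> = H (prefix_of \<omega> K) - \<epsilon>" for \<omega> :: "nat \<Rightarrow> 'a"
  define A where "A = {\<omega>. 0 < max_ergodic_sum f K \<omega>}"
  define S where "S = {\<omega>. \<exists>N\<le>K. \<epsilon> * real N < (\<Sum>n\<in>{k..<N}. g (prefix_of \<omega> n))}"
  have HB: "\<bar>H (prefix_of \<omega> K)\<bar> \<le> (\<Sum>zs\<in>words K. H zs)" for \<omega>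
    using member_le_sum[OF prefix_of_in_words[of \<omega> K], of H] by (simp add: H)
  have [measurable]: "(\<lambda>\<omega>. H (prefix_of \<omega> K)) \<in> borel_measurable Omega"
    "(\<lambda>\<omega>. g (prefix_of \<omega> n)) \<in> borel_measurable Omega" for n
    by (auto intro: measurable_compose[OF measurable_prefix_of])
  have f [measurable]: "f \<in> borel_measurable Omega"
    unfolding f_def by measurable
  have fB: "\<bar>f \<omega>\<bar> \<le> (\<Sum>zs\<in>words K. H zs) + \<epsilon>" for \<omega>
    using HB[of \<omega>] H[of "prefix_of \<omega> K"] eps by (auto simp: f_def)
  have A: "A \<in> sets Omega"
  proof -
    have "{\<omega>\<in>space Omega. 0 < max_ergodic_sum f K \<omega>} \<in> sets Omega" by measurable
    then show ?thesis by (simp add: A_def)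
  qed
  have S: "S \<in> sets Omega"
  proof -
    have "{\<omega>\<in>space Omega. \<exists>N\<le>K. \<epsilon> * real N < (\<Sum>n\<in>{k..<N}. g (prefix_of \<omega> n))} \<in> sets Omega"
      by measurable
    then show ?thesis by (simp add: S_def)
  qed
  \<comment> \<open>Term \<open>n\<close> of the shifted prefix sum is at most \<open>H\<close> on
    the window of length \<open>K\<close> starting at time \<open>n\<close>, so the sum is dominated
    by an ergodic sum of \<open>H\<close>. Since \<open>H\<close> is nonnegative, the terms with
    \<open>n < k\<close> may be added.\<close>
  have "(shift ^^ K) -` S \<subseteq> A"
  proof
    fix \<omega> assume "\<omega> \<in> (shift ^^ K) -` S"
    then obtain N where N: "N \<le> K" "\<epsilon> * real N < (\<Sum>n\<in>{k..<N}. g (prefix_of ((shift ^^ K) \<omega>) n))"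
      by (auto simp: S_def)
    have "(\<Sum>n\<in>{k..<N}. g (prefix_of ((shift ^^ K) \<omega>) n)) \<le> (\<Sum>n\<in>{k..<N}. H (prefix_of ((shift ^^ n) \<omega>) K))"
      using N(1) by (intro sum_mono) (auto simp: prefix_of_funpow_shift intro!: g)
    also have "\<dots> \<le> (\<Sum>n<N. H (prefix_of ((shift ^^ n) \<omega>) K))"
      by (intro sum_mono2) (auto simp: H)
    finally have "0 < (\<Sum>n<N. f ((shift ^^ n) \<omega>))"
      using N(2) by (simp add: f_def sum_subtractf mult.commute)
    also have "\<dots> \<le> max_ergodic_sum f K \<omega>"
      by (rule ergodic_sum_le_max[OF N(1)])
    finally show "\<omega> \<in> A" by (simp add: A_def)
  qed
  then have "measure \<rho> S \<le> measure \<rho> A"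
    unfolding measure_vimage_funpow_shift[OF st S, of K, symmetric]
    by (intro finite_measure_mono) (auto simp: \<rho> A)
  then have "\<epsilon> * measure \<rho> S \<le> \<epsilon> * measure \<rho> A"
    using eps by simp
  also have "\<dots> \<le> (\<integral>\<omega>. H (prefix_of \<omega> K) \<partial>\<rho>)"
  proof -
    have intH: "integrable \<rho> (\<lambda>\<omega>. H (prefix_of \<omega> K))"
      by (rule integrable_const_bound[of _ "\<Sum>zs\<in>words K. H zs"]) (use HB in \<open>auto simp: meas\<close>)
    have intA: "integrable \<rho> (\<lambda>\<omega>. \<epsilon> * indicator A \<omega> :: real)"
      using A by (auto simp: \<rho> emeasure_eq_measure)
    \<comment> \<open>The maximal inequality for \<open>f = H - \<epsilon>\<close>; the part of
      \<open>H\<close> outside \<open>A\<close> is then restored, which can only increase the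
      integral.\<close>
    have "0 \<le> (\<integral>\<omega>. indicator A \<omega> * f \<omega> \<partial>\<rho>)"
      unfolding A_def by (rule maximal_ergodic[OF st f fB])
    also have "\<dots> \<le> (\<integral>\<omega>. H (prefix_of \<omega> K) - \<epsilon> * indicator A \<omega> \<partial>\<rho>)"
    proof (rule integral_mono)
      show "integrable \<rho> (\<lambda>\<omega>. indicator A \<omega> * f \<omega>)"
        using f A fB by (intro integrable_const_bound[of _ "(\<Sum>zs\<in>words K. H zs) + \<epsilon>"])
          (auto simp: meas \<rho> indicator_def H eps less_imp_le add_nonneg_nonneg sum_nonneg)
    qed (use intH intA H in \<open>auto simp: f_def indicator_def\<close>)
    also have "\<dots> = (\<integral>\<omega>. H (prefix_of \<omega> K) \<partial>\<rho>) - \<epsilon> * measure \<rho> A"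
      using intH intA A by (simp add: \<rho>)
    finally show ?thesis by simp
  qed
  also have "\<dots> = (\<Sum>zs\<in>words K. measure \<rho> (cyl zs) * H zs)"
    by (rule integral_prefix_of[OF \<rho>(1,2)])
  finally show ?thesis unfolding S_def .
qed

section \<open>Likelihood martingales\<close>

lemma square_diff_divide:
  fixes v y s :: real
  assumes "v \<noteq> 0"
  shows "(y - v * s)\<^sup>2 / v = y\<^sup>2 / v - 2 * s * y + s\<^sup>2 * v"
  using assms by (simp add: power2_diff add_divide_distrib diff_divide_distrib)
    (simp add: power2_eq_square)

text \<open>If \<open>z\<close> is a fraction of the mass of \<open>w\<close>, the squared fractions \<open>z\<^sup>2 / w\<close> summed over words form
  a bounded increasing sequence, whose increments control how far \<open>z\<close> is from splitting in the
  proportions of \<open>w\<close>.\<close>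

lemma fraction_splits_proportionally:
  fixes z w :: "'a::finite list \<Rightarrow> real"
  assumes w_Nil: "w [] = 1"
    and w_snoc: "\<And>xs. (\<Sum>a\<in>UNIV. w (xs @ [a])) = w xs"
    and z_snoc: "\<And>xs. (\<Sum>a\<in>UNIV. z (xs @ [a])) = z xs"
    and z_nonneg: "\<And>xs. 0 \<le> z xs" and z_le_w: "\<And>xs. z xs \<le> w xs"
  shows "(\<lambda>n. \<Sum>xs\<in>words n. \<Sum>a\<in>UNIV. \<bar>z (xs @ [a]) - w (xs @ [a]) / w xs * z xs\<bar>) \<longlonglongrightarrow> 0"
proof -
  define q where "q n = (\<Sum>xs\<in>words n. (z xs)\<^sup>2 / w xs)" for n
  define d where "d xs a = z (xs @ [a]) - w (xs @ [a]) / w xs * z xs" for xs a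
  have w_nonneg: "0 \<le> w xs" for xs using z_nonneg[of xs] z_le_w[of xs] by simp
  have z0: "z xs = 0" if "w xs = 0" for xs using z_nonneg[of xs] z_le_w[of xs] that by simp
  have w_snoc_le: "w (xs @ [a]) \<le> w xs" for xs a
    unfolding w_snoc[of xs, symmetric] by (rule member_le_sum) (auto simp: w_nonneg)
  have sum_w: "(\<Sum>xs\<in>words n. w xs) = 1" for n
    by (induction n) (simp_all add: w_Nil sum_words_snoc w_snoc)
  \<comment> \<open>After expansion of the square, additivity of \<open>z\<close> and
    \<open>w\<close> merges the last two terms into minus the fraction of the parent word. Words of
    weight zero contribute nothing.\<close>
  have inc: "(\<Sum>a\<in>UNIV. (d xs a)\<^sup>2 / w (xs @ [a])) = (\<Sum>a\<in>UNIV. (z (xs @ [a]))\<^sup>2 / w (xs @ [a])) - (z xs)\<^sup>2 / w xs" for xs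
  proof (cases "w xs = 0")
    case True
    have "w (xs @ [a]) = 0" for a using w_snoc_le[of xs a] w_nonneg[of "xs @ [a]"] True by simp
    then show ?thesis using True by simp
  next
    case False
    have eq: "(d xs a)\<^sup>2 / w (xs @ [a]) = (z (xs @ [a]))\<^sup>2 / w (xs @ [a])
        - 2 * z xs / w xs * z (xs @ [a]) + (z xs)\<^sup>2 / (w xs)\<^sup>2 * w (xs @ [a])" for a
    proof (cases "w (xs @ [a]) = 0")
      case True
      then show ?thesis unfolding d_def by (simp add: z0[OF True])
    next
      case False
      have "(z (xs @ [a]) - w (xs @ [a]) * (z xs / w xs))\<^sup>2 / w (xs @ [a]) = (z (xs @ [a]))\<^sup>2 / w (xs @ [a])
        - 2 * (z xs / w xs) * z (xs @ [a]) + (z xs / w xs)\<^sup>2 * w (xs @ [a])"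
        by (rule square_diff_divide[OF False])
      then show ?thesis
        unfolding d_def by (simp add: power_divide)
    qed
    have "(\<Sum>a\<in>UNIV. (d xs a)\<^sup>2 / w (xs @ [a])) = (\<Sum>a\<in>UNIV. (z (xs @ [a]))\<^sup>2 / w (xs @ [a]))
      - 2 * z xs / w xs * (\<Sum>a\<in>UNIV. z (xs @ [a])) + (z xs)\<^sup>2 / (w xs)\<^sup>2 * (\<Sum>a\<in>UNIV. w (xs @ [a]))"
      unfolding eq by (simp only: sum.distrib sum_subtractf sum_distrib_left)
    also have "\<dots> = (\<Sum>a\<in>UNIV. (z (xs @ [a]))\<^sup>2 / w (xs @ [a]))
      - 2 * z xs / w xs * z xs + (z xs)\<^sup>2 / (w xs)\<^sup>2 * w xs"
      unfolding z_snoc w_snoc ..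
    finally show ?thesis using False by (simp add: power2_eq_square)
  qed
  have q_Suc: "(\<Sum>xs\<in>words n. \<Sum>a\<in>UNIV. (d xs a)\<^sup>2 / w (xs @ [a])) = q (Suc n) - q n" for n
    unfolding inc q_def sum_words_snoc by (simp add: sum_subtractf)
  have inc_q: "incseq q"
  proof (rule incseq_SucI)
    fix n
    have "0 \<le> (\<Sum>xs\<in>words n. \<Sum>a\<in>UNIV. (d xs a)\<^sup>2 / w (xs @ [a]))"
      by (intro sum_nonneg) (simp add: w_nonneg)
    then show "q n \<le> q (Suc n)" unfolding q_Suc by simp
  qed
  have q_le: "q n \<le> 1" for n
  proof -
    have "(z xs)\<^sup>2 / w xs \<le> w xs" for xs
      using power_mono[OF z_le_w z_nonneg, of xs 2] w_nonneg[of xs] z0[of xs]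
      by (cases "w xs = 0") (auto simp: divide_le_eq power2_eq_square)
    then have "q n \<le> (\<Sum>xs\<in>words n. w xs)" unfolding q_def by (intro sum_mono)
    then show ?thesis by (simp add: sum_w)
  qed
  obtain L where L: "q \<longlonglongrightarrow> L"
    using incseq_convergent[OF inc_q] q_le by metis
  \<comment> \<open>Cauchy-Schwarz with the weights \<open>w (xs @ [a])\<close>, whose total is one.
    Dividing by their roots is legitimate because \<open>d\<close> vanishes where the weight
    does.\<close>
  have bound: "(\<Sum>xs\<in>words n. \<Sum>a\<in>UNIV. \<bar>d xs a\<bar>) \<le> sqrt (q (Suc n) - q n)" for n
  proof -
    let ?I = "words n \<times> (UNIV :: 'a set)"
    have abs_d: "\<bar>d xs a\<bar> = \<bar>d xs a\<bar> / sqrt (w (xs @ [a])) * sqrt (w (xs @ [a]))" for xs a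
      using z0[of "xs @ [a]"] by (cases "w (xs @ [a]) = 0") (auto simp: d_def)
    have "(\<Sum>(xs, a)\<in>?I. \<bar>d xs a\<bar>)\<^sup>2
      = (\<Sum>p\<in>?I. \<bar>d (fst p) (snd p)\<bar> / sqrt (w (fst p @ [snd p])) * sqrt (w (fst p @ [snd p])))\<^sup>2"
      unfolding abs_d[symmetric] by (simp add: case_prod_beta)
    also have "\<dots> \<le> (\<Sum>p\<in>?I. (\<bar>d (fst p) (snd p)\<bar> / sqrt (w (fst p @ [snd p])))\<^sup>2)
        * (\<Sum>p\<in>?I. (sqrt (w (fst p @ [snd p])))\<^sup>2)"
      by (rule Cauchy_Schwarz_ineq_sum)
    also have "(\<Sum>p\<in>?I. (\<bar>d (fst p) (snd p)\<bar> / sqrt (w (fst p @ [snd p])))\<^sup>2) = q (Suc n) - q n"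
      unfolding q_Suc[symmetric]
      by (simp add: sum.cartesian_product case_prod_beta power_divide w_nonneg)
    also have "(\<Sum>p\<in>?I. (sqrt (w (fst p @ [snd p])))\<^sup>2) = (\<Sum>xs\<in>words (Suc n). w xs)"
      unfolding sum_words_snoc by (simp add: sum.cartesian_product case_prod_beta w_nonneg)
    finally show ?thesis
      by (intro real_le_rsqrt) (simp add: sum.cartesian_product sum_w)
  qed
  have "(\<lambda>n. sqrt (q (Suc n) - q n)) \<longlonglongrightarrow> sqrt (L - L)"
    by (intro tendsto_intros LIMSEQ_Suc L)
  then have lim: "(\<lambda>n. sqrt (q (Suc n) - q n)) \<longlonglongrightarrow> 0" by simp
  have "norm (\<Sum>xs\<in>words n. \<Sum>a\<in>UNIV. \<bar>d xs a\<bar>) \<le> sqrt (q (Suc n) - q n)" for n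
    using bound[of n] by (simp add: sum_nonneg)
  then have "(\<lambda>n. \<Sum>xs\<in>words n. \<Sum>a\<in>UNIV. \<bar>d xs a\<bar>) \<longlonglongrightarrow> 0"
    by (intro Lim_null_comparison[OF always_eventually lim]) blast
  then show ?thesis unfolding d_def .
qed

section \<open>Mixtures of stationary measures\<close>

definition moment :: "'a::finite \<Rightarrow> (nat \<Rightarrow> 'a) measure \<Rightarrow> nat \<Rightarrow> real" where
  "moment a \<rho> n = (\<Sum>xs\<in>words n. measure \<rho> (cyl xs) * (cond \<rho> xs a)\<^sup>2)"

text \<open>The results of \<open>stationary_weight\<close> expressed through \<open>cond\<close>
  for a single measure, so that they can be applied to almost every component and integrated over
  \<open>lam\<close>.\<close>

lemma
  fixes \<rho> :: "(nat \<Rightarrow> 'a::finite) measure"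
  assumes "stationary \<rho>"
  shows sum_cyl_left: "(\<Sum>ys\<in>words h. measure \<rho> (cyl (ys @ xs))) = measure \<rho> (cyl xs)"
    and sum_cyl: "(\<Sum>xs\<in>words n. measure \<rho> (cyl xs)) = 1"
    and moment_mono: "k \<le> n \<Longrightarrow> moment a \<rho> k \<le> moment a \<rho> n"
    and moment_le_1: "moment a \<rho> n \<le> 1"
    and moment_increment: "(\<Sum>xs\<in>words k. \<Sum>ys\<in>words h. measure \<rho> (cyl (ys @ xs)) * (cond \<rho> (ys @ xs) a - cond \<rho> xs a)\<^sup>2)
      = moment a \<rho> (h + k) - moment a \<rho> k"
    and prob_cond_deviates_le: "0 < e \<Longrightarrow>
      (\<Sum>xs\<in>words k. \<Sum>ys\<in>words h. measure \<rho> (cyl (ys @ xs)) *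
        of_bool (deviates (\<lambda>xs. cond \<rho> xs a) (cond \<rho> xs a) e ys xs))
      \<le> (moment a \<rho> (h + k) - moment a \<rho> k) / e\<^sup>2"
proof -
  interpret stationary_weight "\<lambda>xs. measure \<rho> (cyl xs)"
    by (rule stationary_weight_measure[OF assms])
  have cp: "cp a = (\<lambda>xs. cond \<rho> xs a)" for a
    by (simp add: fun_eq_iff cp_def cond_def)
  have sm: "second_moment a = moment a \<rho>" for a
    by (simp add: fun_eq_iff second_moment_def moment_def cp)
  show "(\<Sum>ys\<in>words h. measure \<rho> (cyl (ys @ xs))) = measure \<rho> (cyl xs)"
    by (rule sum_words_left)
  show "(\<Sum>xs\<in>words n. measure \<rho> (cyl xs)) = 1"
    by (rule sum_words_w)
  show "k \<le> n \<Longrightarrow> moment a \<rho> k \<le> moment a \<rho> n"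
    using second_moment_mono[of k n a] by (simp add: sm)
  show "moment a \<rho> n \<le> 1"
    using second_moment_le_1[of a n] by (simp add: sm)
  show "(\<Sum>xs\<in>words k. \<Sum>ys\<in>words h. measure \<rho> (cyl (ys @ xs)) * (cond \<rho> (ys @ xs) a - cond \<rho> xs a)\<^sup>2)
      = moment a \<rho> (h + k) - moment a \<rho> k"
    using sum_increment_squares[where a = a and h = h and k = k] by (simp only: cp sm)
  show "(\<Sum>xs\<in>words k. \<Sum>ys\<in>words h. measure \<rho> (cyl (ys @ xs)) *
        of_bool (deviates (\<lambda>xs. cond \<rho> xs a) (cond \<rho> xs a) e ys xs))
      \<le> (moment a \<rho> (h + k) - moment a \<rho> k) / e\<^sup>2" if "0 < e"
    using prob_deviates_le[OF that, where a = a and h = h and k = k] by (simp only: cp sm)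
qed

text \<open>Takes the place of Cauchy-Schwarz when a mean absolute value is bounded by a mean
  square: \<open>e\<close> covers small \<open>t\<close>, the quotient covers large
  \<open>t\<close>.\<close>

lemma abs_le_add_square_div:
  fixes t e :: real
  assumes "0 < e"
  shows "\<bar>t\<bar> \<le> e + t\<^sup>2 / e"
proof (cases "\<bar>t\<bar> \<le> e")
  case True
  moreover have "0 \<le> t\<^sup>2 / e" using assms by simp
  ultimately show ?thesis by linarith
next
  case False
  then have "\<bar>t\<bar> * e \<le> \<bar>t\<bar> * \<bar>t\<bar>" by (intro mult_left_mono) auto
  then have "\<bar>t\<bar> \<le> t\<^sup>2 / e" using assms by (simp add: le_divide_eq power2_eq_square)
  then show ?thesis using assms by linarith
qed

locale stationary_mixture =
  fixes mu :: "(nat \<Rightarrow> 'a::finite) measure"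
    and lam :: "(nat \<Rightarrow> 'a) measure measure"
  assumes stationary_mu: "stationary mu"
    and prob_lam: "prob_space lam"
    and sets_lam: "sets lam = sets (prob_algebra Omega)"
    and AE_stationary: "AE \<nu> in lam. stationary \<nu>"
    and mixture: "S \<in> sets Omega \<Longrightarrow> measure mu S = (\<integral>\<nu>. measure \<nu> S \<partial>lam)"
begin

sublocale prob_space lam by (fact prob_lam)

lemma prob_in_lam: "\<nu> \<in> space lam \<Longrightarrow> prob_space \<nu>"
  and sets_in_lam: "\<nu> \<in> space lam \<Longrightarrow> sets \<nu> = sets Omega"
  using sets_eq_imp_space_eq[OF sets_lam] by (auto simp: space_prob_algebra)

lemma measurable_measure_lam [measurable]:
  "S \<in> sets Omega \<Longrightarrow> (\<lambda>\<nu>. measure \<nu> S) \<in> borel_measurable lam"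
  unfolding measurable_cong_sets[OF sets_lam refl] by (rule measurable_measure_prob_algebra)

lemma measurable_cond [measurable]: "(\<lambda>\<nu>. cond \<nu> xs a) \<in> borel_measurable lam"
  unfolding cond_def by measurable

lemma measure_cyl_le_1: "\<nu> \<in> space lam \<Longrightarrow> measure \<nu> (cyl xs) \<le> 1"
  by (rule prob_space.prob_le_1[OF prob_in_lam])

lemma cond_in_lam: "\<nu> \<in> space lam \<Longrightarrow> cond \<nu> xs a \<le> 1"
  by (rule cond_le_1[OF prob_in_lam sets_in_lam])

lemma cond_mu_le_1: "cond mu xs a \<le> 1"
  by (rule cond_le_1[OF stationaryD(1,2)[OF stationary_mu]])

lemma abs_cond_diff_le_1:
  "\<nu> \<in> space lam \<Longrightarrow> \<bar>cond \<nu> xs a - cond mu xs a\<bar> \<le> 1"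
  using cond_in_lam[of \<nu> xs a] cond_mu_le_1[of xs a] cond_nonneg[of \<nu> xs a] cond_nonneg[of mu xs a]
  by (auto simp: abs_le_iff)

lemma integrable_bounded:
  fixes f :: "_ \<Rightarrow> real"
  assumes "f \<in> borel_measurable lam" "\<And>\<nu>. \<nu> \<in> space lam \<Longrightarrow> \<bar>f \<nu>\<bar> \<le> B"
  shows "integrable lam f"
  using assms by (intro integrable_const_bound[of _ B]) auto

lemma integrable_measure_mult:
  fixes f :: "_ \<Rightarrow> real"
  assumes "f \<in> borel_measurable lam" "\<And>\<nu>. \<nu> \<in> space lam \<Longrightarrow> \<bar>f \<nu>\<bar> \<le> B"
  shows "integrable lam (\<lambda>\<nu>. measure \<nu> (cyl xs) * f \<nu>)"
proof (rule integrable_bounded)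
  fix \<nu> assume "\<nu> \<in> space lam"
  then show "\<bar>measure \<nu> (cyl xs) * f \<nu>\<bar> \<le> 1 * B"
    unfolding abs_mult using assms(2) measure_cyl_le_1 by (intro mult_mono) auto
qed (use assms in measurable)

text \<open>The cylinder mass clears the denominator of \<open>cond \<nu>\<close>. What remains is
  the failure of the \<open>f\<close>-weighted masses to split in the proportions of
  \<open>mu\<close>, as measured in \<open>fraction_splits_proportionally\<close>.\<close>

lemma integral_cyl_mult_cond:
  assumes [measurable]: "f \<in> borel_measurable lam" and f: "\<And>\<nu>. \<nu> \<in> space lam \<Longrightarrow> \<bar>f \<nu>\<bar> \<le> 1"
  shows "(\<integral>\<nu>. measure \<nu> (cyl xs) * (f \<nu> * (cond \<nu> xs a - cond mu xs a)) \<partial>lam) =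
    (\<integral>\<nu>. f \<nu> * measure \<nu> (cyl (xs @ [a])) \<partial>lam) - cond mu xs a * (\<integral>\<nu>. f \<nu> * measure \<nu> (cyl xs) \<partial>lam)"
proof -
  have int: "integrable lam (\<lambda>\<nu>. f \<nu> * measure \<nu> (cyl ys))" for ys
    using integrable_measure_mult[of f 1 ys] f by (simp add: mult.commute)
  have "(\<integral>\<nu>. measure \<nu> (cyl xs) * (f \<nu> * (cond \<nu> xs a - cond mu xs a)) \<partial>lam) =
    (\<integral>\<nu>. f \<nu> * measure \<nu> (cyl (xs @ [a])) - cond mu xs a * (f \<nu> * measure \<nu> (cyl xs)) \<partial>lam)"
    by (rule Bochner_Integration.integral_cong)
      (auto simp: measure_cyl_mult_cond[OF prob_in_lam sets_in_lam, symmetric] algebra_simps)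
  then show ?thesis
    using int by simp
qed

text \<open>The case \<open>f = 1\<close>: given the word, the predictions of the components average
  to that of \<open>mu\<close>.\<close>

lemma integral_cyl_cond_diff:
  "(\<integral>\<nu>. measure \<nu> (cyl xs) * (cond \<nu> xs a - cond mu xs a) \<partial>lam) = 0"
  using integral_cyl_mult_cond[of "\<lambda>_. 1" xs a]
    measure_cyl_mult_cond[OF stationaryD(1,2)[OF stationary_mu], of xs a]
  by (simp add: mixture[symmetric] mult.commute)

text \<open>The ratio of \<open>z xs\<close> to the mass of \<open>cyl xs\<close> under
  \<open>mu\<close> is the conditional mean of \<open>f\<close> given the word, a bounded
  martingale. The absolute value stands outside the integral, so a weight correlated with the
  difference of predictions has to be inserted later.\<close>

lemma weighted_cond_diff_tendsto_0:
  assumes [measurable]: "f \<in> borel_measurable lam"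
    and f: "\<And>\<nu>. \<nu> \<in> space lam \<Longrightarrow> 0 \<le> f \<nu>" "\<And>\<nu>. \<nu> \<in> space lam \<Longrightarrow> f \<nu> \<le> 1"
  shows "(\<lambda>n. \<Sum>xs\<in>words n. \<bar>\<integral>\<nu>. measure \<nu> (cyl xs) * (f \<nu> * (cond \<nu> xs a - cond mu xs a)) \<partial>lam\<bar>)
    \<longlonglongrightarrow> 0"
proof -
  define z where "z xs = (\<integral>\<nu>. f \<nu> * measure \<nu> (cyl xs) \<partial>lam)" for xs
  have int: "integrable lam (\<lambda>\<nu>. f \<nu> * measure \<nu> (cyl ys))" for ys
    using integrable_measure_mult[of f 1 ys] f by (simp add: mult.commute)
  note mu = stationaryD(1,2)[OF stationary_mu]
  have snoc: "(\<Sum>b\<in>UNIV. z (xs @ [b])) = z xs" for xs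
  proof -
    have "(\<Sum>b\<in>UNIV. z (xs @ [b])) = (\<integral>\<nu>. (\<Sum>b\<in>UNIV. f \<nu> * measure \<nu> (cyl (xs @ [b]))) \<partial>lam)"
      unfolding z_def by (rule Bochner_Integration.integral_sum[symmetric]) (rule int)
    also have "\<dots> = z xs"
      unfolding z_def by (rule Bochner_Integration.integral_cong)
        (auto simp: measure_cyl_snoc[OF prob_in_lam sets_in_lam] simp flip: sum_distrib_left)
    finally show ?thesis .
  qed
  have nonneg: "0 \<le> z xs" for xs
    unfolding z_def by (rule integral_nonneg_AE) (auto intro!: AE_I2 simp: f)
  have le: "z xs \<le> measure mu (cyl xs)" for xs
    unfolding z_def mixture[OF sets_cyl]
    by (rule integral_mono[OF int]) (use f integrable_measure_mult[of "\<lambda>_. 1" 1 xs] in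
        \<open>auto intro: mult_left_le_one_le\<close>)
  have lim: "(\<lambda>n. \<Sum>xs\<in>words n. \<Sum>b\<in>UNIV. \<bar>z (xs @ [b]) - measure mu (cyl (xs @ [b])) / measure mu (cyl xs) * z xs\<bar>)
    \<longlonglongrightarrow> 0"
    by (rule fraction_splits_proportionally)
      (auto simp: measure_cyl_Nil[OF mu] measure_cyl_snoc[OF mu] snoc nonneg le)
  have eq: "(\<integral>\<nu>. measure \<nu> (cyl xs) * (f \<nu> * (cond \<nu> xs a - cond mu xs a)) \<partial>lam)
    = z (xs @ [a]) - measure mu (cyl (xs @ [a])) / measure mu (cyl xs) * z xs" for xs
    using f by (subst integral_cyl_mult_cond) (auto simp: z_def cond_def)
  have "\<bar>z (xs @ [a]) - measure mu (cyl (xs @ [a])) / measure mu (cyl xs) * z xs\<bar>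
    \<le> (\<Sum>b\<in>UNIV. \<bar>z (xs @ [b]) - measure mu (cyl (xs @ [b])) / measure mu (cyl xs) * z xs\<bar>)" for xs
    by (rule member_le_sum) auto
  then have "norm (\<Sum>xs\<in>words n. \<bar>z (xs @ [a]) - measure mu (cyl (xs @ [a])) / measure mu (cyl xs) * z xs\<bar>)
    \<le> (\<Sum>xs\<in>words n. \<Sum>b\<in>UNIV.
      \<bar>z (xs @ [b]) - measure mu (cyl (xs @ [b])) / measure mu (cyl xs) * z xs\<bar>)" for n
    by (simp add: sum_nonneg sum_mono)
  then show ?thesis
    unfolding eq by (intro Lim_null_comparison[OF always_eventually lim]) blast
qed

section \<open>Averaged second moments of the component predictions\<close>

definition mean_moment :: "'a \<Rightarrow> nat \<Rightarrow> real" where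
  "mean_moment a n = (\<integral>\<nu>. moment a \<nu> n \<partial>lam)"

lemma integrable_moment: "integrable lam (\<lambda>\<nu>. moment a \<nu> n)"
  unfolding moment_def
  by (intro Bochner_Integration.integrable_sum integrable_measure_mult[of _ 1])
    (auto simp: cond_nonneg cond_in_lam power_le_one)

lemma incseq_mean_moment: "incseq (mean_moment a)"
  unfolding incseq_def mean_moment_def
  using AE_stationary by (auto intro!: integral_mono_AE integrable_moment elim!: eventually_mono
      intro: moment_mono)

lemma mean_moment_convergent: "\<exists>L. mean_moment a \<longlonglongrightarrow> L"
proof -
  have "mean_moment a n \<le> 1" for n
  proof -
    have "mean_moment a n \<le> (\<integral>\<nu>. 1 \<partial>lam)"
      unfolding mean_moment_def using AE_stationary
      by (intro integral_mono_AE integrable_moment) (auto elim!: eventually_mono intro: moment_le_1)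
    then show ?thesis by (simp add: prob_space)
  qed
  then show ?thesis using incseq_convergent[OF incseq_mean_moment] by metis
qed

text \<open>From some index on, an increasing convergent sequence lies within \<open>e\<close> below
  its limit, which makes the bound uniform in \<open>h\<close>.\<close>

lemma mean_moment_gap:
  assumes "0 < e"
  shows "\<exists>k0. \<forall>k\<ge>k0. \<forall>h. mean_moment a (h + k) - mean_moment a k \<le> e"
proof -
  obtain L where L: "mean_moment a \<longlonglongrightarrow> L" using mean_moment_convergent by blast
  then obtain k0 where "\<And>k. k0 \<le> k \<Longrightarrow> L - e < mean_moment a k"
    using order_tendstoD(1)[OF L, of "L - e"] assms by (auto simp: eventually_sequentially)
  moreover have "mean_moment a n \<le> L" for n
    by (rule incseq_le[OF incseq_mean_moment L])
  ultimately show ?thesis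
    by (intro exI[of _ k0] allI impI) (smt (verit))
qed

lemma mean_increment:
  "(\<Sum>xs\<in>words k. \<Sum>ys\<in>words h. \<integral>\<nu>. measure \<nu> (cyl (ys @ xs)) * (cond \<nu> (ys @ xs) a - cond \<nu> xs a)\<^sup>2 \<partial>lam)
    = mean_moment a (h + k) - mean_moment a k"
proof -
  have bd: "\<bar>(cond \<nu> (ys @ xs) a - cond \<nu> xs a)\<^sup>2\<bar> \<le> 1" if "\<nu> \<in> space lam" for \<nu> xs ys
    using cond_in_lam[OF that, of "ys @ xs" a] cond_in_lam[OF that, of xs a]
      cond_nonneg[of \<nu> "ys @ xs" a] cond_nonneg[of \<nu> xs a] by (simp add: abs_square_le_1 abs_le_iff)
  have "(\<Sum>xs\<in>words k. \<Sum>ys\<in>words h. \<integral>\<nu>. measure \<nu> (cyl (ys @ xs)) * (cond \<nu> (ys @ xs) a - cond \<nu> xs a)\<^sup>2 \<partial>lam)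
    = (\<integral>\<nu>. (\<Sum>xs\<in>words k. \<Sum>ys\<in>words h. measure \<nu> (cyl (ys @ xs)) * (cond \<nu> (ys @ xs) a - cond \<nu> xs a)\<^sup>2) \<partial>lam)"
    using bd by (simp add: Bochner_Integration.integral_sum Bochner_Integration.integrable_sum
        integrable_measure_mult[of _ 1])
  also have "\<dots> = (\<integral>\<nu>. moment a \<nu> (h + k) - moment a \<nu> k \<partial>lam)"
    using AE_stationary
    by (intro integral_cong_AE) (auto simp: moment_def elim!: eventually_mono
        intro: moment_increment[unfolded moment_def])
  also have "\<dots> = mean_moment a (h + k) - mean_moment a k"
    unfolding mean_moment_def by (simp add: integrable_moment)
  finally show ?thesis .
qed

section \<open>Mean square distance between the predictions of the components and of
  \<open>mu\<close>\<close>

definition mean_square_diff :: "'a \<Rightarrow> nat \<Rightarrow> real" where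
  "mean_square_diff a n =
    (\<Sum>xs\<in>words n. \<integral>\<nu>. measure \<nu> (cyl xs) * (cond \<nu> xs a - cond mu xs a)\<^sup>2 \<partial>lam)"

lemma square_cond_diff_le_1:
  "\<nu> \<in> space lam \<Longrightarrow> \<bar>(cond \<nu> xs a - cond mu xs a)\<^sup>2\<bar> \<le> 1"
  using abs_cond_diff_le_1[of \<nu> xs a] by (simp add: abs_square_le_1)

text \<open>Let \<open>F\<close> and \<open>M\<close> be the predictions of \<open>\<nu>\<close> and
  \<open>mu\<close> from \<open>xs\<close>, and \<open>F'\<close> that of \<open>\<nu>\<close> from
  the last \<open>k\<close> letters \<open>ys\<close>. Then
  \<open>(F - M)^2 = F' (F - M) + (F - F') (F - M) - M (F - M)\<close>. The first term carries a
  weight fixed by \<open>ys\<close>, the second is at most \<open>|F - F'|\<close> and goes to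
  \<open>abs_le_add_square_div\<close>, and the third integrates to zero on each cylinder.\<close>

lemma mean_square_diff_le:
  assumes e: "0 < e"
  shows "mean_square_diff a (m + k) \<le>
    (\<Sum>ys\<in>words k. \<Sum>xs\<in>words (m + k).
      \<bar>\<integral>\<nu>. measure \<nu> (cyl xs) * (cond \<nu> ys a * (cond \<nu> xs a - cond mu xs a)) \<partial>lam\<bar>)
    + e + (mean_moment a (m + k) - mean_moment a k) / e"
proof -
  let ?W = "\<lambda>\<nu> xs. measure \<nu> (cyl xs)"
  let ?F = "\<lambda>\<nu> xs. cond \<nu> xs a" and ?M = "\<lambda>xs. cond mu xs a"
  let ?T = "\<lambda>ys xs. \<bar>\<integral>\<nu>. ?W \<nu> xs * (?F \<nu> ys * (?F \<nu> xs - ?M xs)) \<partial>lam\<bar>"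
  let ?D = "\<lambda>ys xs. \<integral>\<nu>. ?W \<nu> xs * (?F \<nu> xs - ?F \<nu> ys)\<^sup>2 \<partial>lam"
  have FF: "\<bar>?F \<nu> xs - ?F \<nu> ys\<bar> \<le> 1" if "\<nu> \<in> space lam" for \<nu> xs ys
    using cond_in_lam[OF that, of ys a] cond_in_lam[OF that, of xs a]
      cond_nonneg[of \<nu> ys a] cond_nonneg[of \<nu> xs a] by (simp add: abs_le_iff)
  have one: "(\<integral>\<nu>. ?W \<nu> xs * (?F \<nu> xs - ?M xs)\<^sup>2 \<partial>lam) \<le> ?T ys xs + e * ?W mu xs + ?D ys xs / e" for xs ys
  proof -
    have i1: "integrable lam (\<lambda>\<nu>. ?W \<nu> xs * (?F \<nu> ys * (?F \<nu> xs - ?M xs)))"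
      by (rule integrable_measure_mult[of _ 1])
        (auto simp: abs_mult cond_nonneg cond_in_lam abs_cond_diff_le_1 intro!: mult_le_one)
    have i2: "integrable lam (\<lambda>\<nu>. ?W \<nu> xs * (?F \<nu> xs - ?F \<nu> ys)\<^sup>2)"
      by (rule integrable_measure_mult[of _ 1]) (use FF in \<open>auto simp: abs_square_le_1\<close>)
    have i3: "integrable lam (\<lambda>\<nu>. ?W \<nu> xs * (?F \<nu> xs - ?M xs))"
      by (rule integrable_measure_mult[of _ 1]) (auto simp: abs_cond_diff_le_1)
    have i4: "integrable lam (\<lambda>\<nu>. ?W \<nu> xs)"
      using integrable_measure_mult[of "\<lambda>_. 1" 1 xs] by simp
    have i5: "integrable lam (\<lambda>\<nu>. ?W \<nu> xs * (?F \<nu> xs - ?M xs)\<^sup>2)"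
      by (rule integrable_measure_mult[of _ 1]) (auto simp: square_cond_diff_le_1[simplified])
    have "(\<integral>\<nu>. ?W \<nu> xs * (?F \<nu> xs - ?M xs)\<^sup>2 \<partial>lam) \<le>
      (\<integral>\<nu>. ?W \<nu> xs * (?F \<nu> ys * (?F \<nu> xs - ?M xs)) + e * ?W \<nu> xs
        + ?W \<nu> xs * (?F \<nu> xs - ?F \<nu> ys)\<^sup>2 / e - ?M xs * (?W \<nu> xs * (?F \<nu> xs - ?M xs)) \<partial>lam)"
    proof (intro integral_mono Bochner_Integration.integrable_diff Bochner_Integration.integrable_add
        integrable_mult_right integrable_divide i1 i2 i3 i4 i5)
      fix \<nu> assume \<nu>: "\<nu> \<in> space lam"
      have "(?F \<nu> xs - ?F \<nu> ys) * (?F \<nu> xs - ?M xs) \<le> \<bar>?F \<nu> xs - ?F \<nu> ys\<bar> * \<bar>?F \<nu> xs - ?M xs\<bar>"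
        by (metis abs_ge_self abs_mult)
      also have "\<dots> \<le> \<bar>?F \<nu> xs - ?F \<nu> ys\<bar>"
        by (rule mult_left_le) (auto simp: abs_cond_diff_le_1[OF \<nu>])
      also have "\<dots> \<le> e + (?F \<nu> xs - ?F \<nu> ys)\<^sup>2 / e"
        by (rule abs_le_add_square_div[OF e])
      finally have "(?F \<nu> xs - ?M xs)\<^sup>2 \<le> ?F \<nu> ys * (?F \<nu> xs - ?M xs) + e
          + (?F \<nu> xs - ?F \<nu> ys)\<^sup>2 / e - ?M xs * (?F \<nu> xs - ?M xs)"
        by (simp add: power2_eq_square algebra_simps)
      from mult_left_mono[OF this measure_nonneg[of \<nu> "cyl xs"]]
      show "?W \<nu> xs * (?F \<nu> xs - ?M xs)\<^sup>2 \<le> ?W \<nu> xs * (?F \<nu> ys * (?F \<nu> xs - ?M xs)) + e * ?W \<nu> xs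
        + ?W \<nu> xs * (?F \<nu> xs - ?F \<nu> ys)\<^sup>2 / e - ?M xs * (?W \<nu> xs * (?F \<nu> xs - ?M xs))"
        by (simp add: algebra_simps)
    qed
    also have "\<dots> = (\<integral>\<nu>. ?W \<nu> xs * (?F \<nu> ys * (?F \<nu> xs - ?M xs)) \<partial>lam) + e * ?W mu xs + ?D ys xs / e"
      using i1 i2 i3 i4 by (simp add: integral_cyl_cond_diff mixture)
    finally show ?thesis by simp
  qed
  have "mean_square_diff a (m + k) \<le>
    (\<Sum>ys\<in>words k. \<Sum>zs\<in>words m. ?T ys (zs @ ys) + e * ?W mu (zs @ ys) + ?D ys (zs @ ys) / e)"
    unfolding mean_square_diff_def sum_words_append by (intro sum_mono one)
  also have "\<dots> = (\<Sum>ys\<in>words k. \<Sum>zs\<in>words m. ?T ys (zs @ ys))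
      + e * (\<Sum>ys\<in>words k. \<Sum>zs\<in>words m. ?W mu (zs @ ys))
      + (\<Sum>ys\<in>words k. \<Sum>zs\<in>words m. ?D ys (zs @ ys)) / e"
    by (simp add: sum.distrib sum_distrib_left sum_divide_distrib)
  also have "(\<Sum>ys\<in>words k. \<Sum>zs\<in>words m. ?W mu (zs @ ys)) = 1"
    by (simp add: sum_cyl_left[OF stationary_mu] sum_cyl[OF stationary_mu])
  also have "(\<Sum>ys\<in>words k. \<Sum>zs\<in>words m. ?D ys (zs @ ys)) = mean_moment a (m + k) - mean_moment a k"
    by (rule mean_increment)
  \<comment> \<open>Dropping the constraint that \<open>xs\<close> ends in \<open>ys\<close> makes
    the weight \<open>cond \<nu> ys a\<close> independent of the word summed over, as
    \<open>weighted_cond_diff_tendsto_0\<close> requires.\<close>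
  also have "(\<Sum>ys\<in>words k. \<Sum>zs\<in>words m. ?T ys (zs @ ys)) \<le> (\<Sum>ys\<in>words k. \<Sum>xs\<in>words (m + k). ?T ys xs)"
    unfolding sum_words_append
    by (intro sum_mono member_le_sum[where f = "\<lambda>ys'. \<Sum>zs\<in>words m. ?T _ (zs @ ys')"])
      (auto intro!: sum_nonneg)
  finally show ?thesis by simp
qed

lemma mean_square_diff_nonneg: "0 \<le> mean_square_diff a n"
  unfolding mean_square_diff_def by (intro sum_nonneg integral_nonneg_AE) auto

lemma mean_square_diff_tendsto_0: "mean_square_diff a \<longlonglongrightarrow> 0"
proof (rule LIMSEQ_I)
  fix r :: real assume r: "0 < r"
  \<comment> \<open>Three errors of at most \<open>e\<close> arise: from the weighted differences,
    from the splitting of the absolute value, and from the moment gap.\<close>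
  define e where "e = r / 4"
  have e: "0 < e" "0 < e\<^sup>2" using r by (auto simp: e_def)
  obtain k where k: "\<And>h. mean_moment a (h + k) - mean_moment a k \<le> e\<^sup>2"
    using mean_moment_gap[OF e(2)] by blast
  let ?T = "\<lambda>n. \<Sum>ys\<in>words k. \<Sum>xs\<in>words n.
      \<bar>\<integral>\<nu>. measure \<nu> (cyl xs) * (cond \<nu> ys a * (cond \<nu> xs a - cond mu xs a)) \<partial>lam\<bar>"
  \<comment> \<open>With \<open>k\<close> fixed, only finitely many weights occur, and none of them
    changes as \<open>n\<close> grows.\<close>
  have "?T \<longlonglongrightarrow> (\<Sum>ys\<in>(words k :: 'a list set). 0)"
    by (intro tendsto_sum weighted_cond_diff_tendsto_0) (auto simp: cond_nonneg cond_in_lam)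
  then obtain n0 where n0: "\<And>n. n0 \<le> n \<Longrightarrow> ?T n < e"
    using order_tendstoD(2)[of ?T _ sequentially e] e by (auto simp: eventually_sequentially)
  show "\<exists>n0. \<forall>n\<ge>n0. norm (mean_square_diff a n - 0) < r"
  proof (intro exI[of _ "n0 + k"] allI impI)
    fix n assume n: "n0 + k \<le> n"
    define m where "m = n - k"
    have nm: "n = m + k" using n by (simp add: m_def)
    have "mean_square_diff a n \<le> ?T n + e + (mean_moment a (m + k) - mean_moment a k) / e"
      unfolding nm by (rule mean_square_diff_le[OF e(1)])
    moreover have "(mean_moment a (m + k) - mean_moment a k) / e \<le> e"
      using k[of m] e by (simp add: divide_le_eq power2_eq_square)
    moreover have "?T n < e" using n by (intro n0) simp
    ultimately have "mean_square_diff a n < r" using e(1) unfolding e_def by linarith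
    then show "norm (mean_square_diff a n - 0) < r"
      using mean_square_diff_nonneg[of a n] by simp
  qed
qed

section \<open>From mean differences to all Cesaro averages at once\<close>

definition mean_abs_diff :: "'a \<Rightarrow> nat \<Rightarrow> real" where
  "mean_abs_diff a n =
    (\<Sum>xs\<in>words n. \<integral>\<nu>. measure \<nu> (cyl xs) * \<bar>cond \<nu> xs a - cond mu xs a\<bar> \<partial>lam)"

lemma mean_abs_diff_le:
  assumes e: "0 < e"
  shows "mean_abs_diff a n \<le> e + mean_square_diff a n / e"
proof -
  have i1: "integrable lam (\<lambda>\<nu>. measure \<nu> (cyl xs) * \<bar>cond \<nu> xs a - cond mu xs a\<bar>)" for xs
    by (rule integrable_measure_mult[of _ 1]) (auto simp: abs_cond_diff_le_1)
  have i2: "integrable lam (\<lambda>\<nu>. measure \<nu> (cyl xs) * (cond \<nu> xs a - cond mu xs a)\<^sup>2)" for xs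
    by (rule integrable_measure_mult[of _ 1]) (auto simp: square_cond_diff_le_1[simplified])
  have i3: "integrable lam (\<lambda>\<nu>. measure \<nu> (cyl xs))" for xs
    using integrable_measure_mult[of "\<lambda>_. 1" 1 xs] by simp
  have "(\<integral>\<nu>. measure \<nu> (cyl xs) * \<bar>cond \<nu> xs a - cond mu xs a\<bar> \<partial>lam)
    \<le> e * measure mu (cyl xs) + (\<integral>\<nu>. measure \<nu> (cyl xs) * (cond \<nu> xs a - cond mu xs a)\<^sup>2 \<partial>lam) / e" for xs
  proof -
    have "(\<integral>\<nu>. measure \<nu> (cyl xs) * \<bar>cond \<nu> xs a - cond mu xs a\<bar> \<partial>lam)
      \<le> (\<integral>\<nu>. e * measure \<nu> (cyl xs) + measure \<nu> (cyl xs) * (cond \<nu> xs a - cond mu xs a)\<^sup>2 / e \<partial>lam)"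
    proof (intro integral_mono Bochner_Integration.integrable_add integrable_mult_right integrable_divide i1 i2 i3)
      fix \<nu>
      show "measure \<nu> (cyl xs) * \<bar>cond \<nu> xs a - cond mu xs a\<bar>
        \<le> e * measure \<nu> (cyl xs) + measure \<nu> (cyl xs) * (cond \<nu> xs a - cond mu xs a)\<^sup>2 / e"
        using mult_left_mono[OF abs_le_add_square_div[OF e] measure_nonneg[of \<nu> "cyl xs"],
            of "cond \<nu> xs a - cond mu xs a"]
        by (simp add: algebra_simps)
    qed
    then show ?thesis using i2 i3 by (simp add: mixture)
  qed
  then have "mean_abs_diff a n \<le> (\<Sum>xs\<in>words n. e * measure mu (cyl xs)
      + (\<integral>\<nu>. measure \<nu> (cyl xs) * (cond \<nu> xs a - cond mu xs a)\<^sup>2 \<partial>lam) / e)"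
    unfolding mean_abs_diff_def by (intro sum_mono)
  also have "\<dots> = e * (\<Sum>xs\<in>words n. measure mu (cyl xs)) + mean_square_diff a n / e"
    by (simp add: mean_square_diff_def sum.distrib sum_distrib_left sum_divide_distrib)
  finally show ?thesis by (simp add: sum_cyl[OF stationary_mu])
qed

text \<open>The sums start at \<open>k\<close> because the comparison with window length
  \<open>k\<close> covers only longer windows; the omitted terms disappear in the Cesaro limit. The
  cutoff \<open>K\<close> makes the event depend on finitely many letters.\<close>

definition exceed :: "'a \<Rightarrow> real \<Rightarrow> nat \<Rightarrow> nat \<Rightarrow> (nat \<Rightarrow> 'a) measure \<Rightarrow> (nat \<Rightarrow> 'a) set" where
  "exceed a \<epsilon> k K \<nu> = {\<omega>. \<exists>N\<le>K. \<epsilon> * real N <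
    (\<Sum>n\<in>{k..<N}. \<bar>cond \<nu> (prefix_of \<omega> n) a - cond mu (prefix_of \<omega> n) a\<bar>)}"

text \<open>The majorant \<open>H\<close> covers all window lengths from \<open>k\<close> to
  \<open>h + k\<close>: if neither prediction deviates from its value at length \<open>k\<close>,
  the cost is \<open>2 * e\<close>; otherwise an indicator supplies the trivial bound one. The
  deviation of \<open>cond mu\<close> is left as a probability under \<open>\<nu>\<close>, where
  \<open>cond mu\<close> need not be a martingale.\<close>

lemma measure_exceed_le:
  assumes st: "stationary \<nu>" and \<nu>: "\<nu> \<in> space lam" and eps: "0 < \<epsilon>" and e: "0 < e"
  shows "\<epsilon> * measure \<nu> (exceed a \<epsilon> k (h + k) \<nu>) \<le>
    (\<Sum>xs\<in>words k. measure \<nu> (cyl xs) * \<bar>cond \<nu> xs a - cond mu xs a\<bar>) + 2 * e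
    + (\<Sum>xs\<in>words k. \<Sum>ys\<in>words h. measure \<nu> (cyl (ys @ xs)) *
        of_bool (deviates (\<lambda>xs. cond mu xs a) (cond mu xs a) e ys xs))
    + (moment a \<nu> (h + k) - moment a \<nu> k) / e\<^sup>2"
proof -
  let ?W = "\<lambda>xs. measure \<nu> (cyl xs)"
  let ?F = "\<lambda>xs. cond \<nu> xs a" and ?M = "\<lambda>xs. cond mu xs a"
  define H where "H ys xs = \<bar>?F xs - ?M xs\<bar> + 2 * e + of_bool (deviates ?M (?M xs) e ys xs)
    + of_bool (deviates ?F (?F xs) e ys xs)" for ys xs
  have "\<epsilon> * measure \<nu> (exceed a \<epsilon> k (h + k) \<nu>) \<le> (\<Sum>zs\<in>words (h + k). ?W zs * H (take h zs) (drop h zs))"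
    unfolding exceed_def
  proof (rule maximal_prefix_average[OF st eps])
    fix zs :: "'a list" and j
    assume len: "length zs = h + k" and j: "k \<le> j" "j \<le> h + k"
    define ys where "ys = take h zs"
    define xs where "xs = drop h zs"
    define i where "i = h + k - j"
    have i: "i \<le> length ys" using len j by (simp add: ys_def i_def)
    have "zs = ys @ xs" by (simp add: ys_def xs_def)
    then have zs: "drop (h + k - j) zs = drop i ys @ xs"
      using i by (simp add: i_def[symmetric])
    show "\<bar>?F (drop (h + k - j) zs) - ?M (drop (h + k - j) zs)\<bar> \<le> H (take h zs) (drop h zs)"
    proof (cases "deviates ?M (?M xs) e ys xs \<or> deviates ?F (?F xs) e ys xs")
      case True
      then have "1 \<le> H ys xs" using e by (auto simp: H_def)
      then show ?thesis
        using abs_cond_diff_le_1[OF \<nu>, of "drop (h + k - j) zs" a] by (simp add: ys_def xs_def)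
    next
      case False
      then have "\<bar>?M (drop i ys @ xs) - ?M xs\<bar> \<le> e" "\<bar>?F (drop i ys @ xs) - ?F xs\<bar> \<le> e"
        using i by (auto simp: deviates_def not_less)
      then have "\<bar>?F (drop i ys @ xs) - ?M (drop i ys @ xs)\<bar> \<le> \<bar>?F xs - ?M xs\<bar> + 2 * e"
        by linarith
      also have "\<dots> \<le> H ys xs" by (simp add: H_def)
      finally show ?thesis unfolding zs by (simp add: ys_def xs_def)
    qed
  qed (use e in \<open>simp add: H_def\<close>)
  also have "\<dots> = (\<Sum>xs\<in>words k. \<Sum>ys\<in>words h. ?W (ys @ xs) * H ys xs)"
    unfolding sum_words_append by (intro sum.cong refl) (simp add: words_def)
  also have "\<dots> = (\<Sum>xs\<in>words k. ((\<Sum>ys\<in>words h. ?W (ys @ xs)) * (\<bar>?F xs - ?M xs\<bar> + 2 * e)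
      + (\<Sum>ys\<in>words h. ?W (ys @ xs) * of_bool (deviates ?M (?M xs) e ys xs)))
      + (\<Sum>ys\<in>words h. ?W (ys @ xs) * of_bool (deviates ?F (?F xs) e ys xs)))"
    unfolding H_def by (simp only: distrib_left sum.distrib sum_distrib_right add.assoc)
  also have "\<dots> = (\<Sum>xs\<in>words k. ?W xs * \<bar>?F xs - ?M xs\<bar> + ?W xs * (2 * e)
      + (\<Sum>ys\<in>words h. ?W (ys @ xs) * of_bool (deviates ?M (?M xs) e ys xs))
      + (\<Sum>ys\<in>words h. ?W (ys @ xs) * of_bool (deviates ?F (?F xs) e ys xs)))"
    unfolding sum_cyl_left[OF st] by (simp only: distrib_left)
  also have "\<dots> = (\<Sum>xs\<in>words k. ?W xs * \<bar>?F xs - ?M xs\<bar>) + (\<Sum>xs\<in>words k. ?W xs) * (2 * e)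
      + (\<Sum>xs\<in>words k. \<Sum>ys\<in>words h. ?W (ys @ xs) * of_bool (deviates ?M (?M xs) e ys xs))
      + (\<Sum>xs\<in>words k. \<Sum>ys\<in>words h. ?W (ys @ xs) * of_bool (deviates ?F (?F xs) e ys xs))"
    by (simp only: sum.distrib sum_distrib_right)
  finally show ?thesis
    using prob_cond_deviates_le[OF st e, where h = h and k = k and a = a] unfolding sum_cyl[OF st] by linarith
qed

lemma sets_exceed: "exceed a \<epsilon> k K \<nu> \<in> sets Omega"
proof -
  have [measurable]: "(\<lambda>\<omega>. f (prefix_of \<omega> n)) \<in> borel_measurable Omega"
    for f :: "'a list \<Rightarrow> real" and n
    by (auto intro: measurable_compose[OF measurable_prefix_of])
  have [measurable]: "(\<lambda>\<omega>. \<bar>cond \<nu> (prefix_of \<omega> n) a - cond mu (prefix_of \<omega> n) a\<bar>) \<in> borel_measurable Omega" for n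
    by measurable
  have "{\<omega>\<in>space Omega. \<exists>N\<le>K. \<epsilon> * real N <
    (\<Sum>n\<in>{k..<N}. \<bar>cond \<nu> (prefix_of \<omega> n) a - cond mu (prefix_of \<omega> n) a\<bar>)} \<in> sets Omega"
    by measurable
  then show ?thesis by (simp add: exceed_def)
qed

text \<open>The event itself varies with \<open>\<nu>\<close>, but it is decided by the first
  \<open>K\<close> letters, so its measure is a finite sum of measurable functions of
  \<open>\<nu>\<close>.\<close>

lemma measurable_measure_exceed [measurable]:
  "(\<lambda>\<nu>. measure \<nu> (exceed a \<epsilon> k K \<nu>)) \<in> borel_measurable lam"
proof -
  let ?P = "\<lambda>\<nu> zs. \<exists>N\<le>K. \<epsilon> * real N < (\<Sum>n\<in>{k..<N}. \<bar>cond \<nu> (take n zs) a - cond mu (take n zs) a\<bar>)"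
  have "measure \<nu> (exceed a \<epsilon> k K \<nu>) = (\<Sum>zs\<in>words K. measure \<nu> (cyl zs) * of_bool (?P \<nu> zs))"
    if "\<nu> \<in> space lam" for \<nu>
  proof -
    have "exceed a \<epsilon> k K \<nu> = {\<omega>. ?P \<nu> (prefix_of \<omega> K)}"
      unfolding exceed_def by (intro Collect_cong ex_cong1 conj_cong refl)
        (simp add: take_prefix_of)
    then show ?thesis
      using measure_prefix_of[OF prob_in_lam[OF that] sets_in_lam[OF that], of "?P \<nu>" K] by (rule trans[OF arg_cong])
  qed
  moreover have "(\<lambda>\<nu>. \<Sum>zs\<in>words K. measure \<nu> (cyl zs) * of_bool (?P \<nu> zs)) \<in> borel_measurable lam"
    by measurable
  ultimately show ?thesis by (simp cong: measurable_cong)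
qed

text \<open>The deviation event of \<open>cond mu\<close> does not vary with \<open>\<nu>\<close>,
  so averaging turns its probability into that under \<open>mu\<close>, where Kolmogorov's
  inequality applies.\<close>

lemma mean_exceed_le:
  assumes eps: "0 < \<epsilon>" and e: "0 < e"
  shows "\<epsilon> * (\<integral>\<nu>. measure \<nu> (exceed a \<epsilon> k (h + k) \<nu>) \<partial>lam) \<le> mean_abs_diff a k + 2 * e
    + (moment a mu (h + k) - moment a mu k) / e\<^sup>2 + (mean_moment a (h + k) - mean_moment a k) / e\<^sup>2"
proof -
  let ?M = "\<lambda>xs. cond mu xs a"
  let ?A = "\<lambda>xs \<nu>. measure \<nu> (cyl xs) * \<bar>cond \<nu> xs a - cond mu xs a\<bar>"
  let ?B = "\<lambda>xs ys \<nu>. measure \<nu> (cyl (ys @ xs)) * of_bool (deviates ?M (?M xs) e ys xs)"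
  let ?C = "\<lambda>\<nu>. (moment a \<nu> (h + k) - moment a \<nu> k) / e\<^sup>2"
  have iA: "integrable lam (?A xs)" for xs
    by (rule integrable_measure_mult[of _ 1]) (auto simp: abs_cond_diff_le_1)
  have iB: "integrable lam (?B xs ys)" for xs ys
    by (rule integrable_measure_mult[of _ 1]) auto
  have iC: "integrable lam ?C" by (simp add: integrable_moment)
  have iW: "integrable lam (\<lambda>\<nu>. measure \<nu> (exceed a \<epsilon> k (h + k) \<nu>))"
    by (rule integrable_bounded[of _ 1]) (auto intro: prob_space.prob_le_1[OF prob_in_lam])
  note iAs = Bochner_Integration.integrable_sum[of "words k" lam ?A, OF iA]
  have iBs: "integrable lam (\<lambda>\<nu>. \<Sum>xs\<in>words k. \<Sum>ys\<in>words h. ?B xs ys \<nu>)"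
    by (intro Bochner_Integration.integrable_sum iB)
  have intB: "(\<integral>\<nu>. ?B xs ys \<nu> \<partial>lam)
    = measure mu (cyl (ys @ xs)) * of_bool (deviates ?M (?M xs) e ys xs)" for xs ys
    by (simp add: mixture)
  have "(\<integral>\<nu>. \<epsilon> * measure \<nu> (exceed a \<epsilon> k (h + k) \<nu>) \<partial>lam) \<le>
    (\<integral>\<nu>. (\<Sum>xs\<in>words k. ?A xs \<nu>) + 2 * e + (\<Sum>xs\<in>words k. \<Sum>ys\<in>words h. ?B xs ys \<nu>) + ?C \<nu> \<partial>lam)"
  proof (rule integral_mono_AE)
    show "AE \<nu> in lam. \<epsilon> * measure \<nu> (exceed a \<epsilon> k (h + k) \<nu>) \<le>
      (\<Sum>xs\<in>words k. ?A xs \<nu>) + 2 * e + (\<Sum>xs\<in>words k. \<Sum>ys\<in>words h. ?B xs ys \<nu>) + ?C \<nu>"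
      using AE_stationary AE_space by eventually_elim (rule measure_exceed_le[OF _ _ eps e])
  qed (use iW iAs iBs iC in auto)
  also have "\<dots> = (\<Sum>xs\<in>words k. \<integral>\<nu>. ?A xs \<nu> \<partial>lam) + 2 * e
      + (\<Sum>xs\<in>words k. \<Sum>ys\<in>words h. \<integral>\<nu>. ?B xs ys \<nu> \<partial>lam) + (\<integral>\<nu>. ?C \<nu> \<partial>lam)"
    using iAs iBs iC iA iB
    by (simp add: Bochner_Integration.integral_sum Bochner_Integration.integrable_sum prob_space
        del: sum_mult_of_bool_eq)
  also have "(\<Sum>xs\<in>words k. \<integral>\<nu>. ?A xs \<nu> \<partial>lam) = mean_abs_diff a k"
    by (simp add: mean_abs_diff_def)
  also have "(\<integral>\<nu>. ?C \<nu> \<partial>lam) = (mean_moment a (h + k) - mean_moment a k) / e\<^sup>2"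
    by (simp add: mean_moment_def integrable_moment)
  also have "(\<Sum>xs\<in>words k. \<Sum>ys\<in>words h. \<integral>\<nu>. ?B xs ys \<nu> \<partial>lam)
    \<le> (moment a mu (h + k) - moment a mu k) / e\<^sup>2"
    using prob_cond_deviates_le[OF stationary_mu e, where h = h and k = k and a = a]
    by (simp only: intB)
  finally show ?thesis by simp
qed

lemma mean_exceed_small:
  assumes eps: "0 < \<epsilon>" and r: "0 < r"
  shows "\<exists>k. \<forall>h. (\<integral>\<nu>. measure \<nu> (exceed a \<epsilon> k (h + k) \<nu>) \<partial>lam) \<le> r"
proof -
  \<comment> \<open>The errors total at most \<open>6 * e\<close>: \<open>2 * e\<close> from
    \<open>mean_abs_diff\<close>, the explicit \<open>2 * e\<close>, and \<open>e\<close> from each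
    moment gap, which is made at most \<open>e ^ 3\<close> because it is divided by
    \<open>e\<^sup>2\<close>.\<close>
  define e where "e = \<epsilon> * r / 8"
  have e: "0 < e" "0 < e\<^sup>2" "0 < e ^ 3" using eps r by (auto simp: e_def)
  have "incseq (moment a mu)"
    by (auto simp: incseq_def intro: moment_mono[OF stationary_mu])
  then obtain L where L: "moment a mu \<longlonglongrightarrow> L"
    using incseq_convergent[of "moment a mu" 1] moment_le_1[OF stationary_mu] by metis
  then have L': "moment a mu n \<le> L" for n
    by (rule incseq_le[OF \<open>incseq (moment a mu)\<close>])
  have "\<forall>\<^sub>F k in sequentially. L - e ^ 3 < moment a mu k"
    using order_tendstoD(1)[OF L, of "L - e ^ 3"] e by simp
  moreover have "\<forall>\<^sub>F k in sequentially. \<forall>h. mean_moment a (h + k) - mean_moment a k \<le> e ^ 3"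
    using mean_moment_gap[OF e(3), of a] by (simp add: eventually_sequentially)
  moreover have "\<forall>\<^sub>F k in sequentially. mean_square_diff a k < e\<^sup>2"
    using order_tendstoD(2)[OF mean_square_diff_tendsto_0 e(2)] .
  ultimately have "\<forall>\<^sub>F k in sequentially. (\<forall>h. moment a mu (h + k) - moment a mu k \<le> e ^ 3) \<and>
    (\<forall>h. mean_moment a (h + k) - mean_moment a k \<le> e ^ 3) \<and> mean_square_diff a k < e\<^sup>2"
  proof eventually_elim
    case (elim k)
    then show ?case using L' by (smt (verit))
  qed
  then obtain k where k: "\<And>h. moment a mu (h + k) - moment a mu k \<le> e ^ 3"
    "\<And>h. mean_moment a (h + k) - mean_moment a k \<le> e ^ 3" "mean_square_diff a k < e\<^sup>2"
    using eventually_happens'[OF sequentially_bot] by blast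
  have cube: "x / e\<^sup>2 \<le> e" if "x \<le> e ^ 3" for x
    using that e by (simp add: divide_le_eq power2_eq_square power3_eq_cube mult.assoc)
  have "mean_square_diff a k / e \<le> e"
    using k(3) e by (simp add: divide_le_eq power2_eq_square)
  then have "mean_abs_diff a k \<le> 2 * e"
    using mean_abs_diff_le[OF e(1), of a k] by linarith
  then have "\<epsilon> * (\<integral>\<nu>. measure \<nu> (exceed a \<epsilon> k (h + k) \<nu>) \<partial>lam) \<le> 8 * e" for h
    using mean_exceed_le[OF eps e(1), of a k h] cube[OF k(1)[of h]] cube[OF k(2)[of h]] e(1)
    by linarith
  then show ?thesis using eps by (auto simp: e_def)
qed

section \<open>Almost sure convergence of the Cesaro averages\<close>

lemma AE_exceed:
  assumes eps: "0 < \<epsilon>"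
  shows "AE \<nu> in lam. AE \<omega> in \<nu>. \<exists>k. \<forall>K. \<omega> \<notin> exceed a \<epsilon> k K \<nu>"
proof -
  \<comment> \<open>\<open>U k\<close> is the event without cutoff. It decreases in \<open>k\<close>
    and its mean becomes arbitrarily small, so the intersection is null for almost every component.
    Measurability in \<open>\<nu>\<close> passes through both limits.\<close>
  define U where "U k \<nu> = (\<Union>h. exceed a \<epsilon> k (h + k) \<nu>)" for k \<nu>
  have setsU: "U k \<nu> \<in> sets Omega" for k \<nu>
    unfolding U_def using sets_exceed by blast
  have inc: "incseq (\<lambda>h. exceed a \<epsilon> k (h + k) \<nu>)" for k \<nu>
    by (auto simp: incseq_def exceed_def) (meson add_le_mono1 le_trans)
  have dec: "decseq (\<lambda>k. U k \<nu>)" for \<nu>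
  proof (rule antimonoI)
    fix k k' :: nat assume kk: "k \<le> k'"
    show "U k' \<nu> \<subseteq> U k \<nu>"
    proof
      fix \<omega> assume "\<omega> \<in> U k' \<nu>"
      then obtain h N where N: "N \<le> h + k'"
        "\<epsilon> * real N < (\<Sum>n\<in>{k'..<N}. \<bar>cond \<nu> (prefix_of \<omega> n) a - cond mu (prefix_of \<omega> n) a\<bar>)"
        by (auto simp: U_def exceed_def)
      note N(2)
      also have "\<dots> \<le> (\<Sum>n\<in>{k..<N}. \<bar>cond \<nu> (prefix_of \<omega> n) a - cond mu (prefix_of \<omega> n) a\<bar>)"
        using kk by (intro sum_mono2) auto
      \<comment> \<open>The cutoff is still \<open>h + k'\<close>; only the start of the sum has
        moved back.\<close>
      finally have "\<omega> \<in> exceed a \<epsilon> k ((h + (k' - k)) + k) \<nu>"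
        using N(1) kk by (auto simp: exceed_def)
      then show "\<omega> \<in> U k \<nu>" unfolding U_def by blast
    qed
  qed
  have limh: "(\<lambda>h. measure \<nu> (exceed a \<epsilon> k (h + k) \<nu>)) \<longlonglongrightarrow> measure \<nu> (U k \<nu>)"
    if "\<nu> \<in> space lam" for k \<nu>
  proof -
    interpret \<nu>: prob_space \<nu> by (rule prob_in_lam[OF that])
    show ?thesis unfolding U_def
      by (rule \<nu>.finite_Lim_measure_incseq[OF _ inc]) (auto simp: sets_in_lam[OF that] sets_exceed)
  qed
  have limk: "(\<lambda>k. measure \<nu> (U k \<nu>)) \<longlonglongrightarrow> measure \<nu> (\<Inter>k. U k \<nu>)"
    if "\<nu> \<in> space lam" for \<nu>
  proof -
    interpret \<nu>: prob_space \<nu> by (rule prob_in_lam[OF that])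
    show ?thesis
      by (rule \<nu>.finite_Lim_measure_decseq[OF _ dec]) (auto simp: sets_in_lam[OF that] setsU)
  qed
  have measU [measurable]: "(\<lambda>\<nu>. measure \<nu> (U k \<nu>)) \<in> borel_measurable lam" for k
    by (rule borel_measurable_LIMSEQ_real[OF limh]) auto
  have measI [measurable]: "(\<lambda>\<nu>. measure \<nu> (\<Inter>k. U k \<nu>)) \<in> borel_measurable lam"
    by (rule borel_measurable_LIMSEQ_real[OF limk]) auto
  have le_1: "measure \<nu> S \<le> 1" if "\<nu> \<in> space lam" for \<nu> S
    by (rule prob_space.prob_le_1[OF prob_in_lam[OF that]])
  have intU: "integrable lam (\<lambda>\<nu>. measure \<nu> (U k \<nu>))" for k
    by (rule integrable_bounded[of _ 1]) (auto simp: le_1)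
  have intI: "integrable lam (\<lambda>\<nu>. measure \<nu> (\<Inter>k. U k \<nu>))"
    by (rule integrable_bounded[of _ 1]) (auto simp: le_1)
  have "(\<integral>\<nu>. measure \<nu> (\<Inter>k. U k \<nu>) \<partial>lam) \<le> r" if r: "0 < r" for r
  proof -
    obtain k where k: "\<And>h. (\<integral>\<nu>. measure \<nu> (exceed a \<epsilon> k (h + k) \<nu>) \<partial>lam) \<le> r"
      using mean_exceed_small[OF eps r] by blast
    have "(\<integral>\<nu>. measure \<nu> (\<Inter>k. U k \<nu>) \<partial>lam) \<le> (\<integral>\<nu>. measure \<nu> (U k \<nu>) \<partial>lam)"
    proof (rule integral_mono[OF intI intU])
      fix \<nu> assume \<nu>: "\<nu> \<in> space lam"
      then interpret \<nu>: prob_space \<nu> by (rule prob_in_lam)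
      show "measure \<nu> (\<Inter>k. U k \<nu>) \<le> measure \<nu> (U k \<nu>)"
        by (rule \<nu>.finite_measure_mono) (auto simp: sets_in_lam[OF \<nu>] setsU)
    qed
    also have "(\<lambda>h. \<integral>\<nu>. measure \<nu> (exceed a \<epsilon> k (h + k) \<nu>) \<partial>lam) \<longlonglongrightarrow> (\<integral>\<nu>. measure \<nu> (U k \<nu>) \<partial>lam)"
      by (rule integral_dominated_convergence[where w = "\<lambda>_. 1"]) (auto simp: limh le_1 intro!: AE_I2)
    then have "(\<integral>\<nu>. measure \<nu> (U k \<nu>) \<partial>lam) \<le> r"
      by (rule LIMSEQ_le_const2) (use k in blast)
    finally show ?thesis .
  qed
  then have "(\<integral>\<nu>. measure \<nu> (\<Inter>k. U k \<nu>) \<partial>lam) \<le> 0"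
    by (rule field_le_epsilon[of _ 0, simplified])
  moreover have "0 \<le> (\<integral>\<nu>. measure \<nu> (\<Inter>k. U k \<nu>) \<partial>lam)"
    by (rule integral_nonneg_AE) auto
  ultimately have "AE \<nu> in lam. measure \<nu> (\<Inter>k. U k \<nu>) = 0"
    using integral_nonneg_eq_0_iff_AE[OF intI] by simp
  then show ?thesis
    using AE_space
  proof eventually_elim
    case (elim \<nu>)
    interpret \<nu>: prob_space \<nu> by (rule prob_in_lam[OF elim(2)])
    have "(\<Inter>k. U k \<nu>) \<in> null_sets \<nu>"
      using elim setsU by (auto simp: null_sets_def \<nu>.emeasure_eq_measure sets_in_lam)
    then have "AE \<omega> in \<nu>. \<omega> \<notin> (\<Inter>k. U k \<nu>)" by (rule AE_not_in)
    then show ?case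
    proof eventually_elim
      case (elim \<omega>)
      then obtain k where k: "\<omega> \<notin> U k \<nu>" by blast
      \<comment> \<open>Any cutoff \<open>K\<close>, even below \<open>k\<close>, gives an event
        contained in the one with cutoff \<open>K + k\<close>.\<close>
      have "\<omega> \<notin> exceed a \<epsilon> k K \<nu>" for K
        using k incseqD[OF inc[of k \<nu>], of "K - k" K]
        by (auto simp: U_def exceed_def) (meson le_add1)
      then show ?case by blast
    qed
  qed
qed

text \<open>Countably many thresholds suffice, so their exceptional sets form one null set. Off it,
  the sum from some \<open>k\<close> on is at most the threshold times \<open>N\<close>, and the
  first \<open>k\<close> terms add at most \<open>k\<close>.\<close>

lemma AE_cesaro:
  "AE \<nu> in lam. AE \<omega> in \<nu>.
    (\<lambda>N. (\<Sum>n<N. \<bar>cond \<nu> (prefix_of \<omega> n) a - cond mu (prefix_of \<omega> n) a\<bar>) / real N) \<longlonglongrightarrow> 0"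
proof -
  have "AE \<nu> in lam. \<forall>m. AE \<omega> in \<nu>. \<exists>k. \<forall>K. \<omega> \<notin> exceed a (1 / real (Suc m)) k K \<nu>"
    unfolding AE_all_countable by (intro allI AE_exceed) simp
  then show ?thesis
    using AE_space
  proof eventually_elim
    case (elim \<nu>)
    from elim(1) have "AE \<omega> in \<nu>. \<forall>m. \<exists>k. \<forall>K. \<omega> \<notin> exceed a (1 / real (Suc m)) k K \<nu>"
      unfolding AE_all_countable .
    then show ?case
    proof eventually_elim
      case (elim \<omega>)
      define g where "g n = \<bar>cond \<nu> (prefix_of \<omega> n) a - cond mu (prefix_of \<omega> n) a\<bar>" for n
      have g: "0 \<le> g n" "g n \<le> 1" for n
        using abs_cond_diff_le_1[OF \<open>\<nu> \<in> space lam\<close>] by (auto simp: g_def)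
      have "(\<lambda>N. (\<Sum>n<N. g n) / real N) \<longlonglongrightarrow> 0"
      proof (rule LIMSEQ_I)
        fix r :: real assume r: "0 < r"
        obtain m where m: "1 / real (Suc m) < r / 2"
          using r nat_approx_posE[of "r / 2"] by auto
        obtain k where k: "\<And>K. \<omega> \<notin> exceed a (1 / real (Suc m)) k K \<nu>"
          using elim by blast
        have tail: "(\<Sum>n\<in>{k..<N}. g n) \<le> real N / real (Suc m)" for N
          using k[of N] by (auto simp: exceed_def g_def not_less)
        \<comment> \<open>Beyond this index the first \<open>k\<close> terms contribute at most
          \<open>r / 2\<close> to the average.\<close>
        obtain N0 :: nat where N0: "2 * real k / r < real N0"
          using reals_Archimedean2 by blast
        show "\<exists>N0. \<forall>N\<ge>N0. norm ((\<Sum>n<N. g n) / real N - 0) < r"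
        proof (intro exI[of _ "Suc N0"] allI impI)
          fix N assume N: "Suc N0 \<le> N"
          have "(\<Sum>n<N. g n) \<le> (\<Sum>n\<in>{..<k} \<union> {k..<N}. g n)"
            by (intro sum_mono2) (auto simp: g)
          also have "\<dots> = (\<Sum>n<k. g n) + (\<Sum>n\<in>{k..<N}. g n)"
            by (intro sum.union_disjoint) auto
          also have "(\<Sum>n<k. g n) \<le> real k"
            using sum_mono[of "{..<k}" g "\<lambda>_. 1"] g by simp
          finally have "(\<Sum>n<N. g n) \<le> real k + real N / real (Suc m)"
            using tail[of N] by linarith
          moreover have "real N / real (Suc m) < real N * (r / 2)"
            using mult_strict_left_mono[OF m, of "real N"] N by simp
          moreover have "real k \<le> real N * (r / 2)"
          proof -
            have "2 * real k / r < real N" using N0 N by linarith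
            then show ?thesis using r by (simp add: field_simps)
          qed
          ultimately have "(\<Sum>n<N. g n) < real N * r" by linarith
          then show "norm ((\<Sum>n<N. g n) / real N - 0) < r"
            using N by (simp add: g sum_nonneg divide_less_eq mult.commute)
        qed
      qed
      then show ?case by (simp add: g_def)
    qed
  qed
qed

text \<open>The alphabet is finite, so the null sets of the letters can be united, and the maximum
  over letters is at most the sum, whose Cesaro averages vanish letter by letter.\<close>

lemma AE_weakly_merges: "AE \<nu> in lam. weakly_merges mu \<nu>"
proof -
  have "AE \<nu> in lam. \<forall>a. AE \<omega> in \<nu>.
    (\<lambda>N. (\<Sum>n<N. \<bar>cond \<nu> (prefix_of \<omega> n) a - cond mu (prefix_of \<omega> n) a\<bar>) / real N) \<longlonglongrightarrow> 0"
    unfolding AE_all_countable by (intro allI AE_cesaro)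
  then show ?thesis
  proof eventually_elim
    case (elim \<nu>)
    then have "AE \<omega> in \<nu>. \<forall>a.
      (\<lambda>N. (\<Sum>n<N. \<bar>cond \<nu> (prefix_of \<omega> n) a - cond mu (prefix_of \<omega> n) a\<bar>) / real N) \<longlonglongrightarrow> 0"
      unfolding AE_all_countable .
    then show ?case
      unfolding weakly_merges_def
    proof eventually_elim
      case (elim \<omega>)
      let ?d = "\<lambda>a n. \<bar>cond \<nu> (prefix_of \<omega> n) a - cond mu (prefix_of \<omega> n) a\<bar>"
      have lim: "(\<lambda>N. \<Sum>a\<in>UNIV. (\<Sum>n<N. ?d a n) / real N) \<longlonglongrightarrow> 0"
        by (rule tendsto_null_sum) (use elim in blast)
      have dist: "0 \<le> cond_dist mu \<nu> xs"
        "cond_dist mu \<nu> xs \<le> (\<Sum>a\<in>UNIV. \<bar>cond \<nu> xs a - cond mu xs a\<bar>)" for xs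
      proof -
        have le: "\<bar>cond mu xs a - cond \<nu> xs a\<bar> \<le> cond_dist mu \<nu> xs" for a
          unfolding cond_dist_def by (rule Max_ge) auto
        show "0 \<le> cond_dist mu \<nu> xs" using le[of undefined] by linarith
        have "\<bar>cond mu xs a - cond \<nu> xs a\<bar> \<le> (\<Sum>a\<in>UNIV. \<bar>cond \<nu> xs a - cond mu xs a\<bar>)" for a
          unfolding abs_minus_commute[of "cond mu xs a"] by (rule member_le_sum) auto
        then show "cond_dist mu \<nu> xs \<le> (\<Sum>a\<in>UNIV. \<bar>cond \<nu> xs a - cond mu xs a\<bar>)"
          unfolding cond_dist_def by (subst Max_le_iff) auto
      qed
      have "norm ((\<Sum>n<N. cond_dist mu \<nu> (prefix_of \<omega> n)) / real N) \<le> (\<Sum>a\<in>UNIV. (\<Sum>n<N. ?d a n) / real N)" for N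
      proof -
        have "(\<Sum>n<N. cond_dist mu \<nu> (prefix_of \<omega> n)) \<le> (\<Sum>n<N. \<Sum>a\<in>UNIV. ?d a n)"
          by (intro sum_mono dist)
        also have "\<dots> = (\<Sum>a\<in>UNIV. \<Sum>n<N. ?d a n)" by (rule sum.swap)
        finally show ?thesis
          by (simp add: sum_nonneg dist divide_right_mono flip: sum_divide_distrib)
      qed
      then have "(\<lambda>N. (\<Sum>n<N. cond_dist mu \<nu> (prefix_of \<omega> n)) / real N) \<longlonglongrightarrow> 0"
        by (intro Lim_null_comparison[OF always_eventually lim]) blast
      then show ?case by (simp add: strong_cesaro_def dist)
    qed
  qed
qed

end

theorem theorem1:
  fixes mu :: "(nat \<Rightarrow> 'a::finite) measure"
    and lam :: "(nat \<Rightarrow> 'a) measure measure"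
  assumes "stationary mu"
    and "prob_space lam"
    and "sets lam = sets (prob_algebra Omega)"
    and "AE \<nu> in lam. ergodic \<nu>"
    and "\<forall>S\<in>sets Omega. measure mu S = (\<integral>\<nu>. measure \<nu> S \<partial>lam)"
  shows "AE \<nu> in lam. weakly_merges mu \<nu>"
proof -
  have "AE \<nu> in lam. stationary \<nu>"
    using assms(4) by eventually_elim (simp add: ergodic_def)
  then interpret stationary_mixture mu lam
    using assms(1,2,3) assms(5)[rule_format] by (intro stationary_mixture.intro)
  show ?thesis by (rule AE_weakly_merges)
qed

end
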